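(* For every integer $n\geq 3$ there is a finite number $N_2=N_2(n)$ with the following property. Every strictly 2-overlapping family $\mathcal{K}$ of $N_2$ convex sets in $\mathbb{R}^3$ contains a sequence $K_1,\ldots,K_n$ of $n$ distinct sets that is realized by a monotone sequence $\ell_1,\ldots,\ell_n$ of lines in $\mathbb{R}^3$.
   Context: For $p\in\mathbb{R}^3$ let $p^*\in\mathbb{R}^2$ be its vertical projection (dropping the last coordinate), and for $A\subseteq\mathbb{R}^3$ let $A^*=\{p^*:p\in A\}$. A family $\mathcal{K}$ of convex sets in $\mathbb{R}^3$ is strictly 2-overlapping if $\{K^*:K\in\mathcal{K}\}$ is strictly 2-intersecting, i.e. any two of the projected sets intersect but no three distinct ones have a common point. A sequence $K_1,\ldots,K_n$ of convex sets in $\mathbb{R}^3$ is realized by a sequence $\ell_1,\ldots,\ell_n$ of non-vertical lines in $\mathbb{R}^3$ with pairwise non-parallel projections if for all $1\leq i<j\leq n$ the projected segments $(K_i\cap\ell_i)^*$ and $(K_j\cap\ell_j)^*$ intersect (equivalently, the unique vertical line meeting $\ell_i$ and $\ell_j$ meets them within $K_i\cap\ell_i$ and $K_j\cap\ell_j$). For two non-vertical lines $\ell_1,\ell_2$ in $\mathbb{R}^3$ with non-parallel projections, let $p(\ell_1,\ell_2)$ (resp. $p(\ell_2,\ell_1)$) be the intersection point of $\ell_1$ (resp. $\ell_2$) with the unique vertical line meeting both $\ell_1$ and $\ell_2$. Write $\ell_1\prec\ell_2$ (resp. $\ell_1\succ\ell_2$) if $p(\ell_1,\ell_2)$ lies strictly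 below (resp. above) $p(\ell_2,\ell_1)$, and $\ell_1\preceq\ell_2$ (resp. $\ell_1\succeq\ell_2$) if $\ell_1\prec\ell_2$ (resp. $\ell_1\succ\ell_2$) or $\ell_1\cap\ell_2\neq\emptyset$. An ordered sequence of $n\geq 3$ non-vertical lines in $\mathbb{R}^2$, no three through a common point, is an $n$-cap (resp. $n$-cup) if the slopes are strictly decreasing (resp. increasing) and for all $i<j<k$ the point $\ell_i\cap\ell_k$ lies above (resp. below) $\ell_j$. A sequence $\ell_1,\ldots,\ell_n$ ($n\geq3$) of non-vertical lines in $\mathbb{R}^3$ is monotone if (1) the projected sequence $\ell_1^*,\ldots,\ell_n^*$ is an $n$-cap or an $n$-cup, and (2) either $\ell_1\preceq\ell_2\preceq\cdots\preceq\ell_n$ or $\ell_1\succeq\ell_2\succeq\cdots\succeq\ell_n$. *)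

theory Defs
  imports "HOL-Analysis.Analysis"
begin

definition proj :: "real^3 \<Rightarrow> real^2" where
  "proj p = vector [p $ 1, p $ 2]"

text \<open>
  The family is indexed: ``distinct'' refers to the index, not to the value. For the projections
  of a family of sets in space this means that two different sets with the same projection count
  as two members.
\<close>

definition strictly_2_intersecting :: "'i set \<Rightarrow> ('i \<Rightarrow> 'a set) \<Rightarrow> bool" where
  "strictly_2_intersecting I F \<longleftrightarrow>
     (\<forall>i\<in>I. \<forall>j\<in>I. i \<noteq> j \<longrightarrow> F i \<inter> F j \<noteq> {}) \<and>
     (\<forall>i\<in>I. \<forall>j\<in>I. \<forall>k\<in>I. i \<noteq> j \<and> i \<noteq> k \<and> j \<noteq> k \<longrightarrow> F i \<inter> F j \<inter> F k = {})"

definition strictly_2_overlapping :: "(real^3) set set \<Rightarrow> bool" where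
  "strictly_2_overlapping \<K> \<longleftrightarrow> strictly_2_intersecting \<K> (\<lambda>K. proj ` K)"

definition is_line :: "'a::euclidean_space set \<Rightarrow> bool" where
  "is_line L \<longleftrightarrow> affine L \<and> aff_dim L = 1"

definition vertical_line3 :: "(real^3) set \<Rightarrow> bool" where
  "vertical_line3 L \<longleftrightarrow> (\<exists>a b. L = {p. p $ 1 = a \<and> p $ 2 = b})"

definition vertical_line2 :: "(real^2) set \<Rightarrow> bool" where
  "vertical_line2 L \<longleftrightarrow> (\<exists>a. L = {q. q $ 1 = a})"

definition nonvertical_line3 :: "(real^3) set \<Rightarrow> bool" where
  "nonvertical_line3 L \<longleftrightarrow> is_line L \<and> \<not> vertical_line3 L"

definition nonvertical_line2 :: "(real^2) set \<Rightarrow> bool" where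
  "nonvertical_line2 L \<longleftrightarrow> is_line L \<and> \<not> vertical_line2 L"

text \<open>Sequences of length \<open>n\<close> are functions on \<open>nat\<close>, restricted to the indices \<open>1, \<dots>, n\<close>.\<close>

definition realized_by ::
  "nat \<Rightarrow> (nat \<Rightarrow> (real^3) set) \<Rightarrow> (nat \<Rightarrow> (real^3) set) \<Rightarrow> bool" where
  "realized_by n K l \<longleftrightarrow>
     (\<forall>i\<in>{1..n}. nonvertical_line3 (l i)) \<and>
     (\<forall>i\<in>{1..n}. \<forall>j\<in>{1..n}. i < j \<longrightarrow>
        \<not> affine_parallel (proj ` l i) (proj ` l j) \<and>
        proj ` (K i \<inter> l i) \<inter> proj ` (K j \<inter> l j) \<noteq> {})"

text \<open>
  The following is meaningful only for non-vertical lines with non-parallel projections, for which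
  both definite descriptions have a unique witness.
\<close>

definition common_vertical :: "(real^3) set \<Rightarrow> (real^3) set \<Rightarrow> (real^3) set" where
  "common_vertical l1 l2 = (THE v. vertical_line3 v \<and> v \<inter> l1 \<noteq> {} \<and> v \<inter> l2 \<noteq> {})"

definition crossing_point :: "(real^3) set \<Rightarrow> (real^3) set \<Rightarrow> real^3" where
  "crossing_point l1 l2 = (THE p. p \<in> l1 \<inter> common_vertical l1 l2)"

definition line_below :: "(real^3) set \<Rightarrow> (real^3) set \<Rightarrow> bool" where
  "line_below l1 l2 \<longleftrightarrow> crossing_point l1 l2 $ 3 < crossing_point l2 l1 $ 3"

definition line_above :: "(real^3) set \<Rightarrow> (real^3) set \<Rightarrow> bool" where
  "line_above l1 l2 \<longleftrightarrow> crossing_point l1 l2 $ 3 > crossing_point l2 l1 $ 3"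

definition line_below_eq :: "(real^3) set \<Rightarrow> (real^3) set \<Rightarrow> bool" where
  "line_below_eq l1 l2 \<longleftrightarrow> line_below l1 l2 \<or> l1 \<inter> l2 \<noteq> {}"

definition line_above_eq :: "(real^3) set \<Rightarrow> (real^3) set \<Rightarrow> bool" where
  "line_above_eq l1 l2 \<longleftrightarrow> line_above l1 l2 \<or> l1 \<inter> l2 \<noteq> {}"

definition slope :: "(real^2) set \<Rightarrow> real" where
  "slope L = (THE m. \<exists>b. L = {q. q $ 2 = m * q $ 1 + b})"

definition point_above_line :: "real^2 \<Rightarrow> (real^2) set \<Rightarrow> bool" where
  "point_above_line q L \<longleftrightarrow> (\<exists>r\<in>L. r $ 1 = q $ 1 \<and> r $ 2 < q $ 2)"

definition point_below_line :: "real^2 \<Rightarrow> (real^2) set \<Rightarrow> bool" where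
  "point_below_line q L \<longleftrightarrow> (\<exists>r\<in>L. r $ 1 = q $ 1 \<and> q $ 2 < r $ 2)"

definition simple_lines :: "nat \<Rightarrow> (nat \<Rightarrow> (real^2) set) \<Rightarrow> bool" where
  "simple_lines n L \<longleftrightarrow>
     (\<forall>i\<in>{1..n}. nonvertical_line2 (L i)) \<and>
     (\<forall>i\<in>{1..n}. \<forall>j\<in>{1..n}. \<forall>k\<in>{1..n}. i < j \<and> j < k \<longrightarrow> L i \<inter> L j \<inter> L k = {})"

definition is_cap :: "nat \<Rightarrow> (nat \<Rightarrow> (real^2) set) \<Rightarrow> bool" where
  "is_cap n L \<longleftrightarrow> n \<ge> 3 \<and> simple_lines n L \<and>
     (\<forall>i\<in>{1..n}. \<forall>j\<in>{1..n}. i < j \<longrightarrow> slope (L i) > slope (L j)) \<and>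
     (\<forall>i\<in>{1..n}. \<forall>j\<in>{1..n}. \<forall>k\<in>{1..n}. i < j \<and> j < k \<longrightarrow>
        (\<exists>q. L i \<inter> L k = {q} \<and> point_above_line q (L j)))"

definition is_cup :: "nat \<Rightarrow> (nat \<Rightarrow> (real^2) set) \<Rightarrow> bool" where
  "is_cup n L \<longleftrightarrow> n \<ge> 3 \<and> simple_lines n L \<and>
     (\<forall>i\<in>{1..n}. \<forall>j\<in>{1..n}. i < j \<longrightarrow> slope (L i) < slope (L j)) \<and>
     (\<forall>i\<in>{1..n}. \<forall>j\<in>{1..n}. \<forall>k\<in>{1..n}. i < j \<and> j < k \<longrightarrow>
        (\<exists>q. L i \<inter> L k = {q} \<and> point_below_line q (L j)))"

text \<open>
  The relations \<open>line_below_eq\<close> and \<open>line_above_eq\<close> are not transitive; a chain of them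
  relates consecutive lines only.
\<close>

definition monotone_lines :: "nat \<Rightarrow> (nat \<Rightarrow> (real^3) set) \<Rightarrow> bool" where
  "monotone_lines n l \<longleftrightarrow> n \<ge> 3 \<and>
     (\<forall>i\<in>{1..n}. nonvertical_line3 (l i)) \<and>
     (is_cap n (\<lambda>i. proj ` l i) \<or> is_cup n (\<lambda>i. proj ` l i)) \<and>
     ((\<forall>i\<in>{1..<n}. line_below_eq (l i) (l (i + 1))) \<or>
      (\<forall>i\<in>{1..<n}. line_above_eq (l i) (l (i + 1))))"

end

theory Submission
  imports Defs "HOL-Library.Ramsey"
begin

text \<open>
  The problem reduces to the plane: if segments inside the projected sets cross pairwise, then
  lifting their endpoints gives segments inside the original sets, because a lifted segment stays
  in its set and projects onto the whole planar segment. Sorting the lines by slope and applying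
  Ramsey's theorem first to triples (cap or cup) and then to pairs (below or above) yields a
  monotone sequence.

  In the plane, the sets \<open>K\<^sub>i\<close> all meet a vertical line by Helly's theorem, in points \<open>h\<^sub>i\<close> by
  whose height we sort them, and by Ramsey's theorem and a reflection any two of them meet to the
  left of that line. Let \<open>q\<^sub>i\<^sub>j\<close> be the rightmost common point of \<open>K\<^sub>i\<close> and \<open>K\<^sub>j\<close> there. Fix \<open>k\<close>.
  If the points \<open>q\<^sub>k\<^sub>j\<close> move to the right as \<open>j\<close> grows, the segments from \<open>q\<^sub>k\<^sub>j\<close> to \<open>h\<^sub>j\<close> cross
  pairwise: were \<open>q\<^sub>k\<^sub>j\<close> above an earlier segment in \<open>K\<^sub>i\<close>, then \<open>K\<^sub>k\<close> would meet \<open>K\<^sub>i\<close> once more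
  to the right of \<open>q\<^sub>k\<^sub>i\<close>.

  Suppose that they move to the left instead. For any three indices, the set with the middle one
  may be assumed to meet the vertical line through the common point of the outer two, since four
  sets cannot all violate this, and to do so above that point, up to turning the plane upside
  down. Let \<open>a\<^sub>j\<close> be points of \<open>K\<^sub>j\<close> on the vertical line through the leftmost \<open>q\<^sub>k\<^sub>j\<close>. If their order
  is opposite to that of the \<open>h\<^sub>j\<close>, the segments from \<open>a\<^sub>j\<close> to \<open>h\<^sub>j\<close> cross. If it is the same, the
  segments from \<open>q\<^sub>k\<^sub>j\<close> to \<open>a\<^sub>j\<close> cross: were \<open>q\<^sub>k\<^sub>j\<close> above an earlier segment in \<open>K\<^sub>i\<close>, it would belong
  to the three sets \<open>K\<^sub>k\<close>, \<open>K\<^sub>i\<close> and \<open>K\<^sub>j\<close>.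
\<close>

subsection \<open>Sorted and homogeneous index sets\<close>

lemma ex_sorted_int_enumeration:
  fixes key :: "'i \<Rightarrow> 'b::linorder"
  assumes "finite I"
  obtains A :: "int set" and e where "finite A" "card A = card I"
    "bij_betw e A I" "mono_on A (key \<circ> e)"
proof -
  obtain xs where xs: "set xs = I" "distinct xs"
    using finite_distinct_list[OF assms] by blast
  define ys where "ys = sort_key key xs"
  have ys: "set ys = I" "distinct ys" "length ys = card I" "sorted (map key ys)"
    using xs by (auto simp: ys_def distinct_card)
  show ?thesis
  proof (rule that)
    have "bij_betw nat (int ` {..<card I}) {..<card I}"
      by (rule bij_betw_byWitness[of _ int]) auto
    moreover have "bij_betw ((!) ys) {..<card I} I"
      by (rule bij_betw_nth) (use ys in auto)
    ultimately show "bij_betw ((!) ys \<circ> nat) (int ` {..<card I}) I"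
      by (rule bij_betw_trans)
    show "mono_on (int ` {..<card I}) (key \<circ> ((!) ys \<circ> nat))"
      using ys by (fastforce intro!: mono_onI simp: sorted_iff_nth_mono)
  qed (auto simp: card_image)
qed

lemma ex_strict_mono_enumeration:
  fixes H :: "'a::linorder set"
  assumes "finite H"
  obtains g :: "nat \<Rightarrow> 'a" where "bij_betw g {1..card H} H" "strict_mono_on {1..card H} g"
proof
  let ?xs = "sorted_list_of_set H"
  have "bij_betw (\<lambda>i. i - 1) {1..card H} {..<card H}"
    by (rule bij_betw_byWitness[of _ Suc]) auto
  moreover have "bij_betw ((!) ?xs) {..<card H} H"
    by (rule bij_betw_nth) (use assms in auto)
  ultimately show "bij_betw ((!) ?xs \<circ> (\<lambda>i. i - 1)) {1..card H} H"
    by (rule bij_betw_trans)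
  show "strict_mono_on {1..card H} ((!) ?xs \<circ> (\<lambda>i. i - 1))"
    using assms by (auto intro!: strict_mono_onI sorted_wrt_nth_less[OF strict_sorted_list_of_set])
qed

lemma ex_increasing_quadruple:
  fixes H :: "'a::linorder set"
  assumes "finite H" "4 \<le> card H"
  obtains i j k l where "i \<in> H" "j \<in> H" "k \<in> H" "l \<in> H" "i < j" "j < k" "k < l"
proof -
  obtain g where g: "bij_betw g {1..card H} H" "strict_mono_on {1..card H} g"
    using ex_strict_mono_enumeration[OF assms(1)] by blast
  have "g i \<in> H" if "i \<in> {1..card H}" for i
    using bij_betwE[OF g(1)] that by blast
  then show ?thesis
    using that[of "g 1" "g 2" "g 3" "g 4"] assms(2) by (simp add: strict_mono_onD[OF g(2)])
qed

abbreviation ramsey_bound :: "nat \<Rightarrow> nat \<Rightarrow> nat" where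
  "ramsey_bound r m \<equiv> ES r m m"

lemma ramsey_increasing_lists:
  fixes I :: "'a::linorder set" and P :: "'a list \<Rightarrow> bool"
  assumes I: "finite I" "ramsey_bound r m \<le> card I"
  obtains H b where "H \<subseteq> I" "card H = m"
    "\<And>xs. sorted_wrt (<) xs \<Longrightarrow> set xs \<subseteq> H \<Longrightarrow> length xs = r \<Longrightarrow> P xs = b"
proof -
  obtain f where f: "f ` {..<ramsey_bound r m} \<subseteq> I" "inj_on f {..<ramsey_bound r m}"
    using card_le_inj[OF _ I(1), of "{..<ramsey_bound r m}"] I(2) by auto
  define colour :: "nat set \<Rightarrow> nat" where
    "colour S = (if P (sorted_list_of_set (f ` S)) then 1 else 0)" for S
  have "colour \<in> nsets {..<ramsey_bound r m} r \<rightarrow> {..<2}"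
    by (auto simp: colour_def)
  then obtain c H where "c < 2" "H \<in> nsets {..<ramsey_bound r m} ([m, m] ! c)"
    and monochromatic: "colour ` nsets H r \<subseteq> {c}"
    by (rule partn_lstE[OF ramsey2_full]) (auto simp: numeral_2_eq_2)
  then have H: "H \<subseteq> {..<ramsey_bound r m}" "card H = m"
    by (auto simp: nsets_def less_2_cases_iff)
  have inj: "inj_on f H"
    using inj_on_subset[OF f(2) H(1)] .
  have "P xs \<longleftrightarrow> c = 1" if xs: "sorted_wrt (<) xs" "set xs \<subseteq> f ` H" "length xs = r" for xs
  proof -
    obtain S where S: "S \<subseteq> H" "set xs = f ` S"
      using xs(2) by (auto simp: subset_image_iff)
    have "card S = r"
      using card_image[OF inj_on_subset[OF inj S(1)]] S(2) xs
      by (metis distinct_card strict_sorted_iff)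
    then have "S \<in> nsets H r"
      using S(1) finite_subset[OF subset_trans[OF S(1) H(1)]] by (simp add: nsets_def)
    then have "colour S = c"
      using monochromatic by blast
    moreover have "sorted_list_of_set (f ` S) = xs"
      using xs(1) S(2) by (metis sorted_list_of_set.idem_if_sorted_distinct strict_sorted_iff)
    ultimately show ?thesis
      by (auto simp: colour_def split: if_splits)
  qed
  moreover have "f ` H \<subseteq> I" "card (f ` H) = m"
    using f(1) H card_image[OF inj] by auto
  ultimately show ?thesis
    using that by blast
qed

corollary ramsey_pairs:
  fixes I :: "'a::linorder set" and P :: "'a \<Rightarrow> 'a \<Rightarrow> bool"
  assumes "finite I" "ramsey_bound 2 m \<le> card I"
  obtains H b where "H \<subseteq> I" "card H = m" "\<And>i j. i \<in> H \<Longrightarrow> j \<in> H \<Longrightarrow> i < j \<Longrightarrow> P i j = b"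
proof -
  obtain H b where H: "H \<subseteq> I" "card H = m" and
    homogeneous: "\<And>xs. sorted_wrt (<) xs \<Longrightarrow> set xs \<subseteq> H \<Longrightarrow> length xs = 2 \<Longrightarrow> P (xs ! 0) (xs ! 1) = b"
    using ramsey_increasing_lists[OF assms, of "\<lambda>xs. P (xs ! 0) (xs ! 1)"] by metis
  show ?thesis
    by (rule that[OF H, of b]) (use homogeneous[of "[_, _]"] in simp)
qed

corollary ramsey_triples:
  fixes I :: "'a::linorder set" and P :: "'a \<Rightarrow> 'a \<Rightarrow> 'a \<Rightarrow> bool"
  assumes "finite I" "ramsey_bound 3 m \<le> card I"
  obtains H b where "H \<subseteq> I" "card H = m"
    "\<And>i j k. i \<in> H \<Longrightarrow> j \<in> H \<Longrightarrow> k \<in> H \<Longrightarrow> i < j \<Longrightarrow> j < k \<Longrightarrow> P i j k = b"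
proof -
  obtain H b where H: "H \<subseteq> I" "card H = m" and homogeneous: "\<And>xs. sorted_wrt (<) xs \<Longrightarrow> set xs \<subseteq> H \<Longrightarrow>
      length xs = 3 \<Longrightarrow> P (xs ! 0) (xs ! 1) (xs ! 2) = b"
    using ramsey_increasing_lists[OF assms, of "\<lambda>xs. P (xs ! 0) (xs ! 1) (xs ! 2)"] by metis
  show ?thesis
    by (rule that[OF H, of b]) (use homogeneous[of "[_, _, _]"] in simp)
qed

subsection \<open>Crossing segments\<close>

definition pairwise_crossing :: "'i set \<Rightarrow> ('i \<Rightarrow> 'a::real_vector) \<Rightarrow> ('i \<Rightarrow> 'a) \<Rightarrow> bool" where
  "pairwise_crossing J c d \<longleftrightarrow>
     pairwise (\<lambda>i j. closed_segment (c i) (d i) \<inter> closed_segment (c j) (d j) \<noteq> {}) J"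

lemma pairwise_crossing_linorderI:
  fixes J :: "'i::linorder set"
  assumes "\<And>i j. i \<in> J \<Longrightarrow> j \<in> J \<Longrightarrow> i < j \<Longrightarrow>
      closed_segment (c i) (d i) \<inter> closed_segment (c j) (d j) \<noteq> {}"
  shows "pairwise_crossing J c d"
  unfolding pairwise_crossing_def
proof (rule pairwiseI)
  fix i j assume "i \<in> J" "j \<in> J" "i \<noteq> j"
  then show "closed_segment (c i) (d i) \<inter> closed_segment (c j) (d j) \<noteq> {}"
    using assms[of i j] assms[of j i] by (cases i j rule: linorder_cases) (auto simp: Int_commute)
qed

definition has_crossing_segments :: "nat \<Rightarrow> 'i set \<Rightarrow> ('i \<Rightarrow> 'a::real_vector set) \<Rightarrow> bool" where
  "has_crossing_segments n I K \<longleftrightarrow> (\<exists>J c d. J \<subseteq> I \<and> card J = n \<and>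
     (\<forall>i\<in>J. closed_segment (c i) (d i) \<subseteq> K i) \<and> pairwise_crossing J c d)"

lemma has_crossing_segments_mono:
  assumes "has_crossing_segments n I K" "I \<subseteq> I'" "\<And>i. i \<in> I \<Longrightarrow> K i \<subseteq> K' i"
  shows "has_crossing_segments n I' K'"
proof -
  obtain J c d where "J \<subseteq> I" "card J = n"
    "\<forall>i\<in>J. closed_segment (c i) (d i) \<subseteq> K i" "pairwise_crossing J c d"
    using assms(1) unfolding has_crossing_segments_def by blast
  moreover from this have "\<forall>i\<in>J. closed_segment (c i) (d i) \<subseteq> K' i"
    using assms(3) by blast
  ultimately show ?thesis
    unfolding has_crossing_segments_def using assms(2) by blast
qed

lemma has_crossing_segments_reindex:
  assumes "has_crossing_segments n I (K \<circ> f)" "inj_on f I"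
  shows "has_crossing_segments n (f ` I) K"
proof -
  obtain J c d where J: "J \<subseteq> I" "card J = n"
    and cd: "\<forall>i\<in>J. closed_segment (c i) (d i) \<subseteq> K (f i)" "pairwise_crossing J c d"
    using assms(1) unfolding has_crossing_segments_def by auto
  have inj: "inj_on f J"
    using inj_on_subset[OF assms(2) J(1)] .
  let ?g = "the_inv_into J f"
  have g: "?g (f i) = i" if "i \<in> J" for i
    using the_inv_into_f_f[OF inj that] .
  have "f ` J \<subseteq> f ` I" "card (f ` J) = n"
    using J card_image[OF inj] by auto
  moreover have "\<forall>i\<in>f ` J. closed_segment (c (?g i)) (d (?g i)) \<subseteq> K i"
    using cd(1) g by auto
  moreover have "pairwise_crossing (f ` J) (c \<circ> ?g) (d \<circ> ?g)"
    unfolding pairwise_crossing_def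
    by (rule pairwise_imageI) (use pairwiseD[OF cd(2)[unfolded pairwise_crossing_def]] g in simp)
  ultimately show ?thesis
    unfolding has_crossing_segments_def comp_def
    by (intro exI[of _ "f ` J"] exI[of _ "\<lambda>i. c (?g i)"] exI[of _ "\<lambda>i. d (?g i)"] conjI)
qed

lemma has_crossing_segments_linear_image:
  assumes "has_crossing_segments n I K" "linear T"
  shows "has_crossing_segments n I (\<lambda>i. T ` K i)"
proof -
  obtain J c d where J: "J \<subseteq> I" "card J = n"
    and cd: "\<forall>i\<in>J. closed_segment (c i) (d i) \<subseteq> K i" "pairwise_crossing J c d"
    using assms(1) unfolding has_crossing_segments_def by blast
  have seg: "closed_segment (T p) (T q) = T ` closed_segment p q" for p q
    by (rule closed_segment_linear_image[OF assms(2)])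
  have "\<forall>i\<in>J. closed_segment (T (c i)) (T (d i)) \<subseteq> T ` K i"
    unfolding seg using cd(1) by blast
  moreover have "pairwise_crossing J (T \<circ> c) (T \<circ> d)"
    using cd(2) unfolding pairwise_crossing_def comp_def seg
    by (rule pairwise_mono) (metis image_Int_subset image_is_empty subset_empty, simp)
  ultimately show ?thesis
    unfolding has_crossing_segments_def comp_def using J
    by (intro exI[of _ J] exI[of _ "\<lambda>i. T (c i)"] exI[of _ "\<lambda>i. T (d i)"] conjI)
qed

definition reflect :: "'n::finite \<Rightarrow> real^'n \<Rightarrow> real^'n" where
  "reflect k p = (\<chi> i. if i = k then - p $ i else p $ i)"

lemma reflect_nth [simp]: "reflect k p $ i = (if i = k then - p $ i else p $ i)"
  by (simp add: reflect_def)

lemma reflect_reflect [simp]: "reflect k (reflect k p) = p"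
  by (simp add: vec_eq_iff)

lemma linear_reflect: "linear (reflect k)"
  by (simp add: linear_iff vec_eq_iff)

lemma inj_reflect: "inj (reflect k)"
  by (metis injI reflect_reflect)

lemma mem_reflect_image_iff: "p \<in> reflect k ` S \<longleftrightarrow> reflect k p \<in> S"
  by (metis image_iff reflect_reflect)

lemma has_crossing_segments_reflect_iff:
  "has_crossing_segments n I (\<lambda>i. reflect k ` K i) \<longleftrightarrow> has_crossing_segments n I K"
  using has_crossing_segments_linear_image[OF _ linear_reflect, of n I _ k]
  by (fastforce simp: image_image)

lemma closed_segment_nth:
  "(\<lambda>p::real^'n. p $ k) ` closed_segment p q = closed_segment (p $ k) (q $ k)"
  by (rule closed_segment_linear_image[symmetric]) (simp add: linear_iff)

lemma segment_point_at:
  fixes p q :: "real^'n"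
  assumes "x \<in> closed_segment (p $ k) (q $ k)"
  obtains z where "z \<in> closed_segment p q" "z $ k = x"
  using assms by (auto simp flip: closed_segment_nth)

lemma segments_cross:
  fixes a a' b b' :: "real^2"
  assumes "a $ 1 = b $ 1" "a' $ 1 = b' $ 1" "a $ 2 \<le> b $ 2" "b' $ 2 \<le> a' $ 2"
  shows "closed_segment a a' \<inter> closed_segment b b' \<noteq> {}"
proof -
  let ?A = "\<lambda>t. (1 - t) *\<^sub>R a + t *\<^sub>R a'" and ?B = "\<lambda>t. (1 - t) *\<^sub>R b + t *\<^sub>R b'"
  have "\<exists>t\<ge>0. t \<le> 1 \<and> ?A t $ 2 - ?B t $ 2 = 0"
    using assms by (intro IVT'[of "\<lambda>t. ?A t $ 2 - ?B t $ 2"] continuous_intros) auto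
  then obtain t where "0 \<le> t" "t \<le> 1" "?A t $ 2 = ?B t $ 2"
    by auto
  moreover from this have "?A t = ?B t"
    using assms by (simp add: vec_eq_iff forall_2)
  ultimately show ?thesis
    unfolding closed_segment_def by blast
qed

lemma convex_vertical_between:
  fixes K :: "(real^2) set"
  assumes "convex K" "a \<in> K" "b \<in> K" "a $ 1 = p $ 1" "b $ 1 = p $ 1" "a $ 2 \<le> p $ 2" "p $ 2 \<le> b $ 2"
  shows "p \<in> K"
  using segments_cross[of a p b p] closed_segment_subset[OF assms(2,3,1)] assms(4-7) by auto

lemma fan_pairwise_crossing:
  fixes A :: "'i::linorder set" and q h :: "'i \<Rightarrow> real^2"
  assumes h: "\<And>i. i \<in> A \<Longrightarrow> h i $ 1 = \<beta>" "mono_on A (\<lambda>i. h i $ 2)"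
    and between: "\<And>i j. i \<in> A \<Longrightarrow> j \<in> A \<Longrightarrow> i < j \<Longrightarrow> q j $ 1 \<in> closed_segment (q i $ 1) \<beta>"
    and not_above: "\<And>i j z. i \<in> A \<Longrightarrow> j \<in> A \<Longrightarrow> i < j \<Longrightarrow> z \<in> closed_segment (q i) (h i) \<Longrightarrow>
      z $ 1 = q j $ 1 \<Longrightarrow> q j $ 2 \<le> z $ 2"
  shows "pairwise_crossing A q h"
proof (rule pairwise_crossing_linorderI)
  fix i j assume ij: "i \<in> A" "j \<in> A" "i < j"
  obtain z where z: "z \<in> closed_segment (q i) (h i)" "z $ 1 = q j $ 1"
    using segment_point_at[of "q j $ 1" "q i" 1 "h i"] between[OF ij] h(1) ij(1) by auto
  have "closed_segment (q j) (h j) \<inter> closed_segment z (h i) \<noteq> {}"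
    using z not_above[OF ij z] h(1) ij mono_onD[OF h(2), of i j] by (intro segments_cross) auto
  then show "closed_segment (q i) (h i) \<inter> closed_segment (q j) (h j) \<noteq> {}"
    using z(1) subset_closed_segment[of z "h i" "q i" "h i"] by auto
qed

subsection \<open>Strictly 2-intersecting families of convex sets\<close>

locale convex_2_intersecting =
  fixes I :: "'i set" and K :: "'i \<Rightarrow> 'a::euclidean_space set"
  assumes convex: "i \<in> I \<Longrightarrow> convex (K i)"
    and two_intersecting: "strictly_2_intersecting I K"
begin

lemma meet: "i \<in> I \<Longrightarrow> j \<in> I \<Longrightarrow> i \<noteq> j \<Longrightarrow> K i \<inter> K j \<noteq> {}"
  using two_intersecting by (simp add: strictly_2_intersecting_def)

lemma no_common_point:
  assumes "i \<in> I" "j \<in> I" "k \<in> I" "i \<noteq> j" "i \<noteq> k" "j \<noteq> k" "p \<in> K i" "p \<in> K j" "p \<in> K k"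
  shows False
proof -
  have "K i \<inter> K j \<inter> K k = {}"
    using two_intersecting assms(1-6) by (simp add: strictly_2_intersecting_def)
  then show False
    using assms(7-9) by blast
qed

lemma segment_subset: "i \<in> I \<Longrightarrow> p \<in> K i \<Longrightarrow> q \<in> K i \<Longrightarrow> closed_segment p q \<subseteq> K i"
  by (rule closed_segment_subset[OF _ _ convex])

lemma has_crossing_segments_if_pairwise_crossing:
  assumes "J \<subseteq> I" "n \<le> card J" "\<And>i. i \<in> J \<Longrightarrow> c i \<in> K i"
    "\<And>i. i \<in> J \<Longrightarrow> d i \<in> K i" "pairwise_crossing J c d"
  shows "has_crossing_segments n I K"
proof -
  obtain J' where J': "J' \<subseteq> J" "card J' = n"
    using assms(2) by (meson obtain_subset_with_card_n)
  have "\<forall>i\<in>J'. closed_segment (c i) (d i) \<subseteq> K i"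
    using segment_subset assms(1,3,4) J' by blast
  moreover have "pairwise_crossing J' c d"
    using assms(5) J'(1) unfolding pairwise_crossing_def by (rule pairwise_subset)
  ultimately show ?thesis
    unfolding has_crossing_segments_def using J' assms(1) by blast
qed

lemma reindex:
  assumes "inj_on f J" "f ` J \<subseteq> I"
  shows "convex_2_intersecting J (K \<circ> f)"
proof
  have mem: "f i \<in> I" if "i \<in> J" for i
    using assms(2) that by blast
  then show "convex ((K \<circ> f) i)" if "i \<in> J" for i
    using convex that by simp
  have "f i \<noteq> f j" if "i \<in> J" "j \<in> J" "i \<noteq> j" for i j
    using inj_onD[OF assms(1)] that by blast
  with mem show "strictly_2_intersecting J (K \<circ> f)"
    using two_intersecting by (simp add: strictly_2_intersecting_def)
qed

lemma linear_image:
  assumes "linear T" "inj T"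
  shows "convex_2_intersecting I (\<lambda>i. T ` K i)"
proof
  show "convex (T ` K i)" if "i \<in> I" for i
    using convex_linear_image[OF assms(1) convex[OF that]] .
  show "strictly_2_intersecting I (\<lambda>i. T ` K i)"
    using two_intersecting by (simp add: strictly_2_intersecting_def flip: image_Int[OF assms(2)])
qed

lemma ex_compact_subfamily:
  assumes "finite I"
  obtains H where "convex_2_intersecting I H" "\<And>i. i \<in> I \<Longrightarrow> compact (H i) \<and> H i \<subseteq> K i"
proof -
  have "\<exists>p. p \<in> K i \<inter> K j" if "i \<in> I" "j \<in> I - {i}" for i j
    using meet[of i j] that by blast
  then obtain p where p: "\<And>i j. i \<in> I \<Longrightarrow> j \<in> I - {i} \<Longrightarrow> p i j \<in> K i \<inter> K j"
    by metis
  define H where "H i = convex hull (\<Union>j\<in>I - {i}. {p i j, p j i})" for i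
  have sub: "H i \<subseteq> K i" if "i \<in> I" for i
    unfolding H_def using p that by (intro hull_minimal convex) auto
  show ?thesis
  proof (rule that)
    show "compact (H i) \<and> H i \<subseteq> K i" if "i \<in> I" for i
      using assms sub[OF that] by (auto simp: H_def intro: finite_imp_compact_convex_hull)
    have "p i j \<in> H i" "p i j \<in> H j" if "i \<in> I" "j \<in> I" "i \<noteq> j" for i j
      unfolding H_def using that by (auto intro!: hull_inc)
    then have "H i \<inter> H j \<noteq> {}" if "i \<in> I" "j \<in> I" "i \<noteq> j" for i j
      using that by blast
    moreover have "H i \<inter> H j \<inter> H k = {}"
      if "i \<in> I" "j \<in> I" "k \<in> I" "i \<noteq> j" "i \<noteq> k" "j \<noteq> k" for i j k
      using no_common_point[OF that] sub that by blast
    ultimately have "strictly_2_intersecting I H"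
      by (simp add: strictly_2_intersecting_def)
    then show "convex_2_intersecting I H"
      by unfold_locales (simp add: H_def)
  qed
qed

lemma crossing_segments_not_collinear:
  assumes ijk: "i \<in> I" "j \<in> I" "k \<in> I" "i \<noteq> j" "i \<noteq> k" "j \<noteq> k"
    and sub: "S \<subseteq> K i" "T \<subseteq> K j" "U \<subseteq> K k"
    and meets: "S \<inter> T \<noteq> {}" "S \<inter> U \<noteq> {}" "T \<inter> U \<noteq> {}"
  shows "\<not> collinear (S \<union> T)"
proof
  assume col: "collinear (S \<union> T)"
  obtain p q r where p: "p \<in> S" "p \<in> T" and q: "q \<in> S" "q \<in> U" and r: "r \<in> T" "r \<in> U"
    using meets by blast
  have "collinear {p, q, r}"
    using collinear_subset[OF col] p q r by simp
  then consider "p \<in> closed_segment q r" | "q \<in> closed_segment r p" | "r \<in> closed_segment p q"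
    by (auto simp: collinear_between_cases between_mem_segment)
  then have "p \<in> K k \<or> q \<in> K j \<or> r \<in> K i"
    using segment_subset[of k q r] segment_subset[of j r p] segment_subset[of i p q]
      ijk sub p q r by cases blast+
  then show False
    using no_common_point[OF ijk] sub p q r by blast
qed

end

lemma Inter_convex_reals_nonempty:
  fixes X :: "'i \<Rightarrow> real set"
  assumes I: "finite I" "2 \<le> card I" and convex: "\<And>i. i \<in> I \<Longrightarrow> convex (X i)"
    and meet: "\<And>i j. i \<in> I \<Longrightarrow> j \<in> I \<Longrightarrow> i \<noteq> j \<Longrightarrow> X i \<inter> X j \<noteq> {}"
  shows "\<Inter>(X ` I) \<noteq> {}"
proof (cases "card (X ` I) \<le> 1")
  case True
  then have all_eq: "X i = X j" if "i \<in> I" "j \<in> I" for i j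
    using I(1) that by (metis One_nat_def card_le_Suc0_iff_eq finite_imageI imageI)
  obtain i j where ij: "i \<in> I" "j \<in> I" "i \<noteq> j"
    using I by (metis One_nat_def Suc_1 card_le_Suc0_iff_eq not_less_eq_eq)
  then obtain x where "x \<in> X i"
    using meet by blast
  then have "x \<in> \<Inter>(X ` I)"
    using all_eq[OF ij(1)] by blast
  then show ?thesis
    by blast
next
  case False
  show ?thesis
  proof (rule Helly)
    fix T assume "T \<subseteq> X ` I" "card T = DIM(real) + 1"
    then obtain J where J: "J \<subseteq> I" "T = X ` J" "card J = 2"
      unfolding subset_image_inj by (auto simp: card_image)
    then obtain i j where "J = {i, j}" "i \<noteq> j"
      by (meson card_2_iff)
    then show "\<Inter>T \<noteq> {}"
      using meet[of i j] J by simp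
  qed (use False convex in auto)
qed

lemma (in convex_2_intersecting) ex_common_value:
  fixes f :: "'a \<Rightarrow> real"
  assumes I: "finite I" "2 \<le> card I" and f: "linear f"
  obtains x where "\<And>i. i \<in> I \<Longrightarrow> \<exists>p\<in>K i. f p = x"
proof -
  have "f ` K i \<inter> f ` K j \<noteq> {}" if "i \<in> I" "j \<in> I" "i \<noteq> j" for i j
    using meet[OF that] by blast
  then have "\<Inter>((\<lambda>i. f ` K i) ` I) \<noteq> {}"
    by (intro Inter_convex_reals_nonempty[OF I] convex_linear_image[OF f convex])
  then obtain x where "x \<in> f ` K i" if "i \<in> I" for i
    by blast
  then have "\<exists>p\<in>K i. f p = x" if "i \<in> I" for i
    using that by (metis imageE)
  then show ?thesis
    by (rule that)
qed

subsection \<open>Families meeting a common vertical line\<close>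

text \<open>The indices are integers, so that negation reverses their order.\<close>

locale anchored_family = convex_2_intersecting I K
  for I :: "int set" and K :: "int \<Rightarrow> (real^2) set" +
  fixes \<beta> :: real and h :: "int \<Rightarrow> real^2" and q :: "int \<Rightarrow> int \<Rightarrow> real^2"
  assumes anchor: "i \<in> I \<Longrightarrow> h i \<in> K i" "i \<in> I \<Longrightarrow> h i $ 1 = \<beta>"
    and anchor_mono: "mono_on I (\<lambda>i. h i $ 2)"
    and contact: "i \<in> I \<Longrightarrow> j \<in> I \<Longrightarrow> i < j \<Longrightarrow> q i j \<in> K i \<inter> K j \<and> q i j $ 1 \<le> \<beta>"
    and contact_rightmost: "i \<in> I \<Longrightarrow> j \<in> I \<Longrightarrow> i < j \<Longrightarrow> p \<in> K i \<inter> K j \<Longrightarrow> p $ 1 \<le> \<beta> \<Longrightarrow>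
      p $ 1 \<le> q i j $ 1"
begin

lemma subfamily:
  assumes J: "J \<subseteq> I"
  shows "anchored_family J K \<beta> h q"
proof -
  interpret sub: convex_2_intersecting J K
    using reindex[of id J] J by simp
  show ?thesis
    using anchor contact contact_rightmost mono_on_subset[OF anchor_mono J] J
    by unfold_locales blast+
qed

lemma reflected_reversal:
  "anchored_family (uminus ` I) (\<lambda>i. reflect 2 ` K (- i)) \<beta> (\<lambda>i. reflect 2 (h (- i)))
     (\<lambda>i j. reflect 2 (q (- j) (- i)))"
proof -
  interpret reversed: convex_2_intersecting "uminus ` I" "K \<circ> uminus"
    by (rule reindex) auto
  interpret reflected: convex_2_intersecting "uminus ` I" "\<lambda>i. reflect 2 ` (K \<circ> uminus) i"
    by (rule reversed.linear_image[OF linear_reflect inj_reflect])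
  show ?thesis
  proof
    show "convex (reflect 2 ` K (- i))" if "i \<in> uminus ` I" for i
      using reflected.convex[OF that] by simp
    show "strictly_2_intersecting (uminus ` I) (\<lambda>i. reflect 2 ` K (- i))"
      using reflected.two_intersecting by simp
    show "mono_on (uminus ` I) (\<lambda>i. reflect 2 (h (- i)) $ 2)"
      using anchor_mono by (auto simp: mono_on_def)
    show "p $ 1 \<le> reflect 2 (q (- j) (- i)) $ 1"
      if "i \<in> uminus ` I" "j \<in> uminus ` I" "i < j"
        "p \<in> reflect 2 ` K (- i) \<inter> reflect 2 ` K (- j)" "p $ 1 \<le> \<beta>" for i j p
      using contact_rightmost[of "- j" "- i" "reflect 2 p"] that
      by (auto simp: mem_reflect_image_iff)
  qed (use anchor contact in \<open>auto simp: mem_reflect_image_iff\<close>)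
qed

lemma contact_not_above:
  assumes kij: "k \<in> I" "i \<in> I" "j \<in> I" "k < i" "k < j" and less: "q k i $ 1 < q k j $ 1"
    and z: "z \<in> closed_segment (q k i) (h i)" "z $ 1 = q k j $ 1"
  shows "q k j $ 2 \<le> z $ 2"
proof (rule ccontr)
  assume above: "\<not> q k j $ 2 \<le> z $ 2"
  have "closed_segment z (h i) \<inter> closed_segment (q k j) (h k) \<noteq> {}"
    using z(2) anchor(2) above mono_onD[OF anchor_mono, of k i] kij by (intro segments_cross) auto
  then obtain w where w: "w \<in> closed_segment z (h i)" "w \<in> closed_segment (q k j) (h k)"
    by blast
  have "z \<in> K i"
    using z(1) segment_subset[of i "q k i" "h i"] contact[of k i] anchor(1) kij by auto
  then have "w \<in> K i"
    using w(1) segment_subset[of i z "h i"] anchor(1) kij by auto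
  moreover have "w \<in> K k"
    using w(2) segment_subset[of k "q k j" "h k"] contact[of k j] anchor(1) kij by auto
  moreover have "w $ 1 \<in> closed_segment (q k j $ 1) \<beta>"
    using w(2) anchor(2)[OF kij(1)] closed_segment_nth[of 1 "q k j" "h k"] by auto
  then have "q k j $ 1 \<le> w $ 1" "w $ 1 \<le> \<beta>"
    using contact[of k j] kij by (auto simp: closed_segment_eq_real_ivl)
  ultimately show False
    using contact_rightmost[of k i w] kij less by auto
qed

lemma rising_contacts_cross:
  assumes kJ: "k \<in> I" "J \<subseteq> I" "\<And>i. i \<in> J \<Longrightarrow> k < i" "n \<le> card J"
    and rising: "\<And>i j. i \<in> J \<Longrightarrow> j \<in> J \<Longrightarrow> i < j \<Longrightarrow> q k i $ 1 < q k j $ 1"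
  shows "has_crossing_segments n I K"
proof (rule has_crossing_segments_if_pairwise_crossing[OF kJ(2,4)])
  show mem: "q k i \<in> K i" "h i \<in> K i" if "i \<in> J" for i
    using contact[of k i] anchor(1)[of i] kJ that by auto
  show "pairwise_crossing J (q k) h"
  proof (rule fan_pairwise_crossing)
    show "h i $ 1 = \<beta>" if "i \<in> J" for i
      using anchor(2) kJ(2) that by blast
    show "mono_on J (\<lambda>i. h i $ 2)"
      by (rule mono_on_subset[OF anchor_mono kJ(2)])
    fix i j assume ij: "i \<in> J" "j \<in> J" "i < j"
    show "q k j $ 1 \<in> closed_segment (q k i $ 1) \<beta>"
      using rising[OF ij] contact[of k j] kJ ij by (auto simp: closed_segment_eq_real_ivl)
    show "q k j $ 2 \<le> z $ 2" if "z \<in> closed_segment (q k i) (h i)" "z $ 1 = q k j $ 1" for z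
      using contact_not_above[OF kJ(1) _ _ _ _ rising[OF ij] that] kJ(2,3) ij by blast
  qed
qed

lemma transversals_cross:
  assumes J: "J \<subseteq> I" and a: "\<And>i. i \<in> J \<Longrightarrow> a i $ 1 = \<alpha>"
    and reversed: "\<And>i j. i \<in> J \<Longrightarrow> j \<in> J \<Longrightarrow> i < j \<Longrightarrow> a j $ 2 \<le> a i $ 2"
  shows "pairwise_crossing J a h"
proof (rule pairwise_crossing_linorderI)
  fix i j assume ij: "i \<in> J" "j \<in> J" "i < j"
  then have "closed_segment (a j) (h j) \<inter> closed_segment (a i) (h i) \<noteq> {}"
    using a anchor(2) mono_onD[OF anchor_mono, of i j] reversed[OF ij] J
    by (intro segments_cross) auto
  then show "closed_segment (a i) (h i) \<inter> closed_segment (a j) (h j) \<noteq> {}"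
    by (simp add: Int_commute)
qed

lemma left_fan_cross:
  assumes kJ: "k \<in> I" "J \<subseteq> I" "\<And>i. i \<in> J \<Longrightarrow> k < i"
    and a: "\<And>i. i \<in> J \<Longrightarrow> a i \<in> K i" "\<And>i. i \<in> J \<Longrightarrow> a i $ 1 = \<alpha>" "mono_on J (\<lambda>i. a i $ 2)"
    and right: "\<And>i. i \<in> J \<Longrightarrow> \<alpha> \<le> q k i $ 1"
    and falling: "\<And>i j. i \<in> J \<Longrightarrow> j \<in> J \<Longrightarrow> i < j \<Longrightarrow> q k j $ 1 \<le> q k i $ 1"
    and below: "\<And>i j. i \<in> J \<Longrightarrow> j \<in> J \<Longrightarrow> i < j \<Longrightarrow> \<exists>z\<in>K i. z $ 1 = q k j $ 1 \<and> q k j $ 2 \<le> z $ 2"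
  shows "pairwise_crossing J (q k) a"
proof (rule fan_pairwise_crossing[OF a(2,3)])
  fix i j assume ij: "i \<in> J" "j \<in> J" "i < j"
  show "q k j $ 1 \<in> closed_segment (q k i $ 1) \<alpha>"
    using falling[OF ij] right[OF ij(2)] by (auto simp: closed_segment_eq_real_ivl)
  fix z assume z: "z \<in> closed_segment (q k i) (a i)" "z $ 1 = q k j $ 1"
  have IJ: "i \<in> I" "j \<in> I" "k < i" "k < j"
    using ij kJ by auto
  have zK: "z \<in> K i"
    using z(1) segment_subset[OF IJ(1) _ a(1)[OF ij(1)], of "q k i"]
      contact[OF kJ(1) IJ(1,3)] by blast
  obtain z' where z': "z' \<in> K i" "z' $ 1 = q k j $ 1" "q k j $ 2 \<le> z' $ 2"
    using below[OF ij] by blast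
  show "q k j $ 2 \<le> z $ 2"
  proof (rule ccontr)
    assume "\<not> q k j $ 2 \<le> z $ 2"
    then have "q k j \<in> K i"
      using convex_vertical_between[OF convex[OF IJ(1)] zK z'(1)] z(2) z' by simp
    then show False
      using no_common_point[of k i j "q k j"] contact[OF kJ(1) IJ(2,4)] kJ(1) IJ ij(3) by simp
  qed
qed

lemma falling_contacts_cross:
  assumes kJ: "k \<in> I" "J \<subseteq> I" "\<And>i. i \<in> J \<Longrightarrow> k < i" "finite J" "Suc (ramsey_bound 2 n) \<le> card J"
    and falling: "\<And>i j. i \<in> J \<Longrightarrow> j \<in> J \<Longrightarrow> i < j \<Longrightarrow> q k j $ 1 \<le> q k i $ 1"
    and below: "\<And>i j. i \<in> J \<Longrightarrow> j \<in> J \<Longrightarrow> i < j \<Longrightarrow> \<exists>z\<in>K i. z $ 1 = q k j $ 1 \<and> q k j $ 2 \<le> z $ 2"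
  shows "has_crossing_segments n I K"
proof -
  define M where "M = Max J"
  have "J \<noteq> {}"
    using kJ(5) by auto
  then have M: "M \<in> J" "\<And>i. i \<in> J - {M} \<Longrightarrow> i < M"
    using kJ(4) Max_ge[of J] by (auto simp: M_def less_le)
  have "\<exists>p\<in>K i. p $ 1 = q k M $ 1" if "i \<in> J - {M}" for i
    using below[of i M] M that by blast
  then obtain a where a: "\<And>i. i \<in> J - {M} \<Longrightarrow> a i \<in> K i" "\<And>i. i \<in> J - {M} \<Longrightarrow> a i $ 1 = q k M $ 1"
    by metis
  obtain H b where H: "H \<subseteq> J - {M}" "card H = n"
    and order: "\<And>i j. i \<in> H \<Longrightarrow> j \<in> H \<Longrightarrow> i < j \<Longrightarrow> (a i $ 2 \<le> a j $ 2) = b"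
    by (rule ramsey_pairs[of "J - {M}" n "\<lambda>i j. a i $ 2 \<le> a j $ 2"]) (use kJ(4,5) M(1) in auto)
  have HJ: "H \<subseteq> J" "H \<subseteq> I" and aH: "\<And>i. i \<in> H \<Longrightarrow> a i \<in> K i" "\<And>i. i \<in> H \<Longrightarrow> a i $ 1 = q k M $ 1"
    using H(1) kJ(2) a by auto
  show ?thesis
  proof (cases b)
    case True
    have "mono_on H (\<lambda>i. a i $ 2)"
      using order True by (intro mono_onI) (metis order.order_iff_strict)
    moreover have "q k M $ 1 \<le> q k i $ 1" if "i \<in> H" for i
      using falling M H(1) that by blast
    ultimately have "pairwise_crossing H (q k) a"
      using left_fan_cross[OF kJ(1) HJ(2) kJ(3) aH] falling below HJ(1) by (simp add: subset_iff)
    moreover have "q k i \<in> K i" if "i \<in> H" for i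
      using contact[of k i] kJ that HJ(1) by auto
    ultimately show ?thesis
      using has_crossing_segments_if_pairwise_crossing[OF HJ(2)] H(2) aH(1) by blast
  next
    case False
    have "pairwise_crossing H a h"
    proof (rule transversals_cross[OF HJ(2) aH(2)])
      show "a j $ 2 \<le> a i $ 2" if "i \<in> H" "j \<in> H" "i < j" for i j
        using order[OF that] False by simp
    qed
    then show ?thesis
      using has_crossing_segments_if_pairwise_crossing[OF HJ(2)] H(2) anchor(1) aH(1) HJ(2) by blast
  qed
qed

end

definition fan_bound :: "nat \<Rightarrow> nat" where
  "fan_bound n = Suc (ramsey_bound 2 (n + Suc (ramsey_bound 2 n)))"

lemma (in anchored_family) crossing_segments_if_contacts_below:
  assumes I: "finite I" "fan_bound n \<le> card I"
    and below: "\<And>i j k. i \<in> I \<Longrightarrow> j \<in> I \<Longrightarrow> k \<in> I \<Longrightarrow> i < j \<Longrightarrow> j < k \<Longrightarrow>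
      \<exists>z\<in>K j. z $ 1 = q i k $ 1 \<and> q i k $ 2 \<le> z $ 2"
  shows "has_crossing_segments n I K"
proof -
  define k where "k = Min I"
  have "I \<noteq> {}"
    using I(2) by (auto simp: fan_bound_def)
  then have k: "k \<in> I" "\<And>i. i \<in> I - {k} \<Longrightarrow> k < i"
    using I(1) Min_le[of I] by (auto simp: k_def less_le)
  obtain J b where J: "J \<subseteq> I - {k}" "card J = n + Suc (ramsey_bound 2 n)"
    and rising: "\<And>i j. i \<in> J \<Longrightarrow> j \<in> J \<Longrightarrow> i < j \<Longrightarrow> (q k i $ 1 < q k j $ 1) = b"
    by (rule ramsey_pairs[of "I - {k}" "n + Suc (ramsey_bound 2 n)" "\<lambda>i j. q k i $ 1 < q k j $ 1"])
       (use I k(1) in \<open>auto simp: fan_bound_def\<close>)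
  have J': "J \<subseteq> I" "\<And>i. i \<in> J \<Longrightarrow> k < i" "finite J"
    using J(1) k(2) I(1) by (auto intro: finite_subset)
  show ?thesis
  proof (cases b)
    case True
    show ?thesis
      by (rule rising_contacts_cross[OF k(1) J'(1,2)]) (use J(2) rising True in auto)
  next
    case False
    show ?thesis
    proof (rule falling_contacts_cross[OF k(1) J'])
      show "Suc (ramsey_bound 2 n) \<le> card J"
        using J(2) by simp
    next
      fix i j assume ij: "i \<in> J" "j \<in> J" "i < j"
      show "q k j $ 1 \<le> q k i $ 1"
        using rising[OF ij] False by simp
      show "\<exists>z\<in>K i. z $ 1 = q k j $ 1 \<and> q k j $ 2 \<le> z $ 2"
        using below[OF k(1)] J' ij by blast
    qed
  qed
qed

lemma (in anchored_family) crossing_segments_if_contacts_above: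
  assumes I: "finite I" "fan_bound n \<le> card I"
    and above: "\<And>i j k. i \<in> I \<Longrightarrow> j \<in> I \<Longrightarrow> k \<in> I \<Longrightarrow> i < j \<Longrightarrow> j < k \<Longrightarrow>
      \<exists>z\<in>K j. z $ 1 = q i k $ 1 \<and> z $ 2 \<le> q i k $ 2"
  shows "has_crossing_segments n I K"
proof -
  interpret reversed: anchored_family "uminus ` I" "\<lambda>i. reflect 2 ` K (- i)" \<beta>
    "\<lambda>i. reflect 2 (h (- i))" "\<lambda>i j. reflect 2 (q (- j) (- i))"
    by (rule reflected_reversal)
  have "has_crossing_segments n (uminus ` I) (\<lambda>i. reflect 2 ` K (- i))"
  proof (rule reversed.crossing_segments_if_contacts_below)
    fix i j k assume "i \<in> uminus ` I" "j \<in> uminus ` I" "k \<in> uminus ` I" "i < j" "j < k"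
    then obtain z where "z \<in> K (- j)" "z $ 1 = q (- k) (- i) $ 1" "z $ 2 \<le> q (- k) (- i) $ 2"
      using above[of "- k" "- j" "- i"] by auto
    then show "\<exists>z\<in>reflect 2 ` K (- j). z $ 1 = reflect 2 (q (- k) (- i)) $ 1 \<and>
        reflect 2 (q (- k) (- i)) $ 2 \<le> z $ 2"
      by (intro bexI[of _ "reflect 2 z"]) auto
  qed (use I in \<open>auto simp: card_image\<close>)
  then have "has_crossing_segments n (uminus ` I) (K \<circ> uminus)"
    by (simp add: has_crossing_segments_reflect_iff comp_def)
  then have "has_crossing_segments n (uminus ` uminus ` I) K"
    by (rule has_crossing_segments_reindex) simp
  then show ?thesis
    by (simp add: image_image)
qed

lemma (in anchored_family) reaches_contact:
  assumes ijkl: "i \<in> I" "j \<in> I" "k \<in> I" "l \<in> I" "i < j" "j < k" "k < l"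
    and avoids: "\<not> (\<exists>z\<in>K j. z $ 1 = q i k $ 1)"
  shows "\<exists>z\<in>K k. z $ 1 = q j l $ 1"
proof -
  have "q i k $ 1 < p $ 1" if "p \<in> K j" for p
  proof (rule ccontr)
    assume "\<not> q i k $ 1 < p $ 1"
    then have "q i k $ 1 \<in> closed_segment (p $ 1) (h j $ 1)"
      using anchor(2)[of j] contact[of i k] ijkl by (auto simp: closed_segment_eq_real_ivl)
    then obtain z where "z \<in> closed_segment p (h j)" "z $ 1 = q i k $ 1"
      by (rule segment_point_at)
    then show False
      using avoids segment_subset[OF ijkl(2) that anchor(1)] ijkl(2) by blast
  qed
  then have "q i k $ 1 < q j l $ 1"
    using contact[of j l] ijkl by simp
  then have "q j l $ 1 \<in> closed_segment (q i k $ 1) (h k $ 1)"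
    using anchor(2)[of k] contact[of j l] ijkl by (auto simp: closed_segment_eq_real_ivl)
  then obtain z where "z \<in> closed_segment (q i k) (h k)" "z $ 1 = q j l $ 1"
    by (rule segment_point_at)
  moreover have "closed_segment (q i k) (h k) \<subseteq> K k"
    using segment_subset anchor(1) contact[of i k] ijkl by simp
  ultimately show ?thesis
    by blast
qed

definition anchored_bound :: "nat \<Rightarrow> nat" where
  "anchored_bound n = ramsey_bound 3 (4 + ramsey_bound 3 (fan_bound n))"

lemma (in anchored_family) crossing_segments:
  assumes I: "finite I" "anchored_bound n \<le> card I"
  shows "has_crossing_segments n I K"
proof -
  obtain J b where J: "J \<subseteq> I" "card J = 4 + ramsey_bound 3 (fan_bound n)"
    and reach: "\<And>i j k. i \<in> J \<Longrightarrow> j \<in> J \<Longrightarrow> k \<in> J \<Longrightarrow> i < j \<Longrightarrow> j < k \<Longrightarrow> (\<exists>z\<in>K j. z $ 1 = q i k $ 1) = b"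
    by (rule ramsey_triples[OF I(1), of "4 + ramsey_bound 3 (fan_bound n)"
          "\<lambda>i j k. \<exists>z\<in>K j. z $ 1 = q i k $ 1"])
       (use I(2) in \<open>auto simp: anchored_bound_def\<close>)
  have finJ: "finite J"
    using J(1) I(1) by (rule finite_subset)
  obtain i j k l where "i \<in> J" "j \<in> J" "k \<in> J" "l \<in> J" "i < j" "j < k" "k < l"
    by (rule ex_increasing_quadruple[OF finJ]) (use J(2) in \<open>simp, blast\<close>)
  then have b
    using reaches_contact[of i j k l] reach[of i j k] reach[of j k l] J(1) by auto
  obtain H c where H: "H \<subseteq> J" "card H = fan_bound n"
    and below: "\<And>i j k. i \<in> H \<Longrightarrow> j \<in> H \<Longrightarrow> k \<in> H \<Longrightarrow> i < j \<Longrightarrow> j < k \<Longrightarrow>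
      (\<exists>z\<in>K j. z $ 1 = q i k $ 1 \<and> q i k $ 2 \<le> z $ 2) = c"
    by (rule ramsey_triples[OF finJ, of "fan_bound n"
          "\<lambda>i j k. \<exists>z\<in>K j. z $ 1 = q i k $ 1 \<and> q i k $ 2 \<le> z $ 2"])
       (use J(2) in auto)
  have finH: "finite H" and HI: "H \<subseteq> I"
    using H(1) J(1) finJ by (auto intro: finite_subset)
  interpret sub: anchored_family H K \<beta> h q
    by (rule subfamily[OF HI])
  have "has_crossing_segments n H K"
  proof (cases c)
    case True
    then show ?thesis
      using sub.crossing_segments_if_contacts_below[OF finH] H(2) below by simp
  next
    case False
    have "\<exists>z\<in>K j. z $ 1 = q i k $ 1 \<and> z $ 2 \<le> q i k $ 2"
      if "i \<in> H" "j \<in> H" "k \<in> H" "i < j" "j < k" for i j k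
      using reach[of i j k] \<open>b\<close> below[OF that] False H(1) that by (meson linear subsetD)
    then show ?thesis
      using sub.crossing_segments_if_contacts_above[OF finH] H(2) by simp
  qed
  then show ?thesis
    by (rule has_crossing_segments_mono) (use HI in auto)
qed

lemma compact_attains_largest_coordinate_le:
  fixes S :: "(real^'n) set"
  assumes "compact S" "\<exists>p\<in>S. p $ k \<le> x"
  obtains p where "p \<in> S" "p $ k \<le> x" "\<And>p'. p' \<in> S \<Longrightarrow> p' $ k \<le> x \<Longrightarrow> p' $ k \<le> p $ k"
proof -
  define T where "T = S \<inter> {p. p $ k \<le> x}"
  have "compact T"
    unfolding T_def using assms(1) by (intro compact_Int_closed closed_Collect_le continuous_intros)
  moreover have "T \<noteq> {}"
    using assms(2) by (auto simp: T_def)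
  ultimately have "\<exists>p\<in>T. \<forall>p'\<in>T. p' $ k \<le> p $ k"
    by (rule continuous_attains_sup) (intro continuous_intros)
  then show ?thesis
    using that by (auto simp: T_def)
qed

lemma crossing_segments_if_meet_left:
  fixes I :: "int set" and K :: "int \<Rightarrow> (real^2) set"
  assumes fam: "convex_2_intersecting I K" and compact: "\<And>i. i \<in> I \<Longrightarrow> compact (K i)"
    and I: "finite I" "anchored_bound n \<le> card I"
    and h: "\<And>i. i \<in> I \<Longrightarrow> h i \<in> K i" "\<And>i. i \<in> I \<Longrightarrow> h i $ 1 = \<beta>" "mono_on I (\<lambda>i. h i $ 2)"
    and left: "\<And>i j. i \<in> I \<Longrightarrow> j \<in> I \<Longrightarrow> i < j \<Longrightarrow> \<exists>p\<in>K i \<inter> K j. p $ 1 \<le> \<beta>"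
  shows "has_crossing_segments n I K"
proof -
  have "\<exists>p. p \<in> K i \<inter> K j \<and> p $ 1 \<le> \<beta> \<and> (\<forall>p'\<in>K i \<inter> K j. p' $ 1 \<le> \<beta> \<longrightarrow> p' $ 1 \<le> p $ 1)"
    if "i \<in> I" "j \<in> I" "i < j" for i j
    using compact_attains_largest_coordinate_le[OF compact_Int[OF compact compact] left[OF that]]
      that by metis
  then obtain q where "\<And>i j. i \<in> I \<Longrightarrow> j \<in> I \<Longrightarrow> i < j \<Longrightarrow> q i j \<in> K i \<inter> K j \<and> q i j $ 1 \<le> \<beta> \<and>
      (\<forall>p'\<in>K i \<inter> K j. p' $ 1 \<le> \<beta> \<longrightarrow> p' $ 1 \<le> q i j $ 1)"
    by metis
  then have "anchored_family I K \<beta> h q"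
    using h by (intro anchored_family.intro fam anchored_family_axioms.intro) blast+
  then show ?thesis
    using I by (rule anchored_family.crossing_segments)
qed

lemma crossing_segments_anchored:
  fixes I :: "int set" and K :: "int \<Rightarrow> (real^2) set"
  assumes fam: "convex_2_intersecting I K" and compact: "\<And>i. i \<in> I \<Longrightarrow> compact (K i)"
    and I: "finite I" "ramsey_bound 2 (anchored_bound n) \<le> card I"
    and h: "\<And>i. i \<in> I \<Longrightarrow> h i \<in> K i" "\<And>i. i \<in> I \<Longrightarrow> h i $ 1 = \<beta>" "mono_on I (\<lambda>i. h i $ 2)"
  shows "has_crossing_segments n I K"
proof -
  obtain J b where J: "J \<subseteq> I" "card J = anchored_bound n"
    and left: "\<And>i j. i \<in> J \<Longrightarrow> j \<in> J \<Longrightarrow> i < j \<Longrightarrow> (\<exists>p\<in>K i \<inter> K j. p $ 1 \<le> \<beta>) = b"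
    by (rule ramsey_pairs[OF I, of "\<lambda>i j. \<exists>p\<in>K i \<inter> K j. p $ 1 \<le> \<beta>"]) blast
  have J_card: "finite J" "anchored_bound n \<le> card J"
    using J I(1) by (auto intro: finite_subset)
  interpret convex_2_intersecting J K
    using convex_2_intersecting.reindex[OF fam, of id J] J(1) by simp
  have compact_J: "compact (K i)" if "i \<in> J" for i
    using compact J(1) that by blast
  have h_J: "\<And>i. i \<in> J \<Longrightarrow> h i \<in> K i" "\<And>i. i \<in> J \<Longrightarrow> h i $ 1 = \<beta>" "mono_on J (\<lambda>i. h i $ 2)"
    using h(1,2) J(1) mono_on_subset[OF h(3) J(1)] by auto
  have "has_crossing_segments n J K"
  proof (cases b)
    case True
    show ?thesis
      by (rule crossing_segments_if_meet_left[OF convex_2_intersecting_axioms compact_J J_card h_J])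
         (use left True in auto)
  next
    case False
    have "has_crossing_segments n J (\<lambda>i. reflect 1 ` K i)"
    proof (rule crossing_segments_if_meet_left[OF linear_image[OF linear_reflect inj_reflect] _
          J_card])
      show "compact (reflect 1 ` K i)" if "i \<in> J" for i
        using compact_J[OF that]
        by (intro compact_continuous_image linear_continuous_on
            linear_reflect[unfolded linear_conv_bounded_linear])
      fix i j assume ij: "i \<in> J" "j \<in> J" "i < j"
      then obtain p where "p \<in> K i" "p \<in> K j"
        using meet[of i j] by blast
      moreover from this have "\<beta> \<le> p $ 1"
        using left[OF ij] False by force
      ultimately show "\<exists>p\<in>reflect 1 ` K i \<inter> reflect 1 ` K j. p $ 1 \<le> - \<beta>"
        by (intro bexI[of _ "reflect 1 p"]) auto
    next
      show "mono_on J (\<lambda>i. reflect 1 (h i) $ 2)"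
        using h_J(3) by simp
    qed (use h_J in auto)
    then show ?thesis
      by (simp add: has_crossing_segments_reflect_iff)
  qed
  then show ?thesis
    by (rule has_crossing_segments_mono) (use J(1) in auto)
qed

definition planar_bound :: "nat \<Rightarrow> nat" where
  "planar_bound n = ramsey_bound 2 (anchored_bound n) + 2"

lemma crossing_segments_compact:
  fixes K :: "'i \<Rightarrow> (real^2) set"
  assumes fam: "convex_2_intersecting I K" and compact: "\<And>i. i \<in> I \<Longrightarrow> compact (K i)"
    and I: "finite I" "planar_bound n \<le> card I"
  shows "has_crossing_segments n I K"
proof -
  obtain \<beta> where "\<And>i. i \<in> I \<Longrightarrow> \<exists>p\<in>K i. p $ 1 = \<beta>"
    by (rule convex_2_intersecting.ex_common_value[OF fam I(1), of "\<lambda>p. p $ 1"])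
       (use I(2) in \<open>auto simp: planar_bound_def linear_iff\<close>)
  then obtain h where h: "\<And>i. i \<in> I \<Longrightarrow> h i \<in> K i" "\<And>i. i \<in> I \<Longrightarrow> h i $ 1 = \<beta>"
    by metis
  obtain A :: "int set" and e where A: "finite A" "card A = card I" and e: "bij_betw e A I"
    and sorted: "mono_on A ((\<lambda>i. h i $ 2) \<circ> e)"
    by (rule ex_sorted_int_enumeration[OF I(1), of "\<lambda>i. h i $ 2"])
  have e_inj: "inj_on e A" and e_image: "e ` A = I"
    using e by (auto simp: bij_betw_def)
  have "has_crossing_segments n A (K \<circ> e)"
  proof (rule crossing_segments_anchored)
    show "convex_2_intersecting A (K \<circ> e)"
      using convex_2_intersecting.reindex[OF fam e_inj] e_image by simp
    show "mono_on A (\<lambda>a. (h \<circ> e) a $ 2)"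
      using sorted by (simp add: comp_def)
  qed (use compact h A I(2) e_image in \<open>auto simp: planar_bound_def\<close>)
  then show ?thesis
    using has_crossing_segments_reindex[OF _ e_inj] e_image by blast
qed

theorem crossing_segments:
  fixes K :: "'i \<Rightarrow> (real^2) set"
  assumes "convex_2_intersecting I K" "finite I" "planar_bound n \<le> card I"
  shows "has_crossing_segments n I K"
proof -
  interpret convex_2_intersecting I K by fact
  obtain H where "convex_2_intersecting I H" "\<And>i. i \<in> I \<Longrightarrow> compact (H i) \<and> H i \<subseteq> K i"
    using ex_compact_subfamily[OF assms(2)] by blast
  then have "has_crossing_segments n I H" "\<And>i. i \<in> I \<Longrightarrow> H i \<subseteq> K i"
    using crossing_segments_compact[of I H n] assms(2,3) by simp_all
  then show ?thesis
    by (intro has_crossing_segments_mono[of n I H I K]) auto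
qed

subsection \<open>Lines as graphs over the first coordinate\<close>

definition line2 :: "real \<Rightarrow> real \<Rightarrow> (real^2) set" where
  "line2 m b = {q. q $ 2 = m * q $ 1 + b}"

definition line3 :: "real \<Rightarrow> real \<Rightarrow> real \<Rightarrow> real \<Rightarrow> (real^3) set" where
  "line3 m b u v = {p. p $ 2 = m * p $ 1 + b \<and> p $ 3 = u * p $ 1 + v}"

definition graph_line3 :: "(real^3) set \<Rightarrow> bool" where
  "graph_line3 L \<longleftrightarrow> (\<exists>m b u v. L = line3 m b u v)"

lemma proj_nth [simp]: "proj p $ 1 = p $ 1" "proj p $ 2 = p $ 2"
  by (simp_all add: proj_def)

lemma linear_proj: "linear proj"
  by (simp add: linear_iff vec_eq_iff forall_2)

lemma proj_line3: "proj ` line3 m b u v = line2 m b"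
proof
  show "line2 m b \<subseteq> proj ` line3 m b u v"
  proof
    fix q assume "q \<in> line2 m b"
    then show "q \<in> proj ` line3 m b u v"
      by (intro image_eqI[of _ _ "vector [q $ 1, q $ 2, u * q $ 1 + v]"])
         (auto simp: line2_def line3_def vec_eq_iff forall_2)
  qed
qed (auto simp: line2_def line3_def)

lemma line2_affine_hull: "line2 m b = affine hull {vector [0, b], vector [1, m + b]}"
proof -
  have "q = vector [0, b] + (q $ 1) *\<^sub>R (vector [1, m + b] - vector [0, b])"
    if "q \<in> line2 m b" for q
    using that by (auto simp: line2_def vec_eq_iff forall_2 algebra_simps)
  moreover have "vector [0, b] + t *\<^sub>R (vector [1, m + b] - vector [0, b]) \<in> line2 m b" for t
    by (simp add: line2_def algebra_simps)
  ultimately show ?thesis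
    unfolding affine_hull_2_alt by blast
qed

lemma line3_affine_hull:
  "line3 m b u v = affine hull {vector [0, b, v], vector [1, m + b, u + v]}"
proof -
  have "p = vector [0, b, v] + (p $ 1) *\<^sub>R (vector [1, m + b, u + v] - vector [0, b, v])"
    if "p \<in> line3 m b u v" for p
    using that by (auto simp: line3_def vec_eq_iff forall_3 algebra_simps)
  moreover have "vector [0, b, v] + t *\<^sub>R (vector [1, m + b, u + v] - vector [0, b, v])
      \<in> line3 m b u v" for t
    by (simp add: line3_def algebra_simps)
  ultimately show ?thesis
    unfolding affine_hull_2_alt by blast
qed

lemma collinear_line2: "collinear (line2 m b)"
  by (simp add: line2_affine_hull collinear_affine_hull_collinear collinear_2)

lemma nonvertical_line2_line2: "nonvertical_line2 (line2 m b)"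
proof -
  have "(vector [0, b] :: real^2) \<noteq> vector [1, m + b]"
    by (simp add: vec_eq_iff forall_2)
  then have "is_line (line2 m b)"
    by (simp add: is_line_def line2_affine_hull aff_dim_affine_hull)
  moreover have "line2 m b \<noteq> {q. q $ 1 = a}" for a
  proof -
    have "vector [0, b] \<in> line2 m b" "vector [1, m + b] \<in> line2 m b"
      by (auto simp: line2_def)
    then show ?thesis
      by force
  qed
  ultimately show ?thesis
    by (simp add: nonvertical_line2_def vertical_line2_def)
qed

lemma graph_line3_nonvertical:
  assumes "graph_line3 L"
  shows "nonvertical_line3 L"
proof -
  obtain m b u v where L: "L = line3 m b u v"
    using assms by (auto simp: graph_line3_def)
  have "(vector [0, b, v] :: real^3) \<noteq> vector [1, m + b, u + v]"
    by (simp add: vec_eq_iff forall_3)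
  then have "is_line L"
    by (simp add: L is_line_def line3_affine_hull aff_dim_affine_hull)
  moreover have "L \<noteq> {p. p $ 1 = x \<and> p $ 2 = y}" for x y
  proof -
    have "vector [0, b, v] \<in> L" "vector [1, m + b, u + v] \<in> L"
      by (auto simp: L line3_def)
    then show ?thesis
      by force
  qed
  ultimately show ?thesis
    by (simp add: nonvertical_line3_def vertical_line3_def)
qed

lemma graph_line3_through:
  assumes "c $ 1 \<noteq> d $ 1"
  obtains L where "graph_line3 L" "c \<in> L" "d \<in> L"
proof -
  define m where "m = (d $ 2 - c $ 2) / (d $ 1 - c $ 1)"
  define u where "u = (d $ 3 - c $ 3) / (d $ 1 - c $ 1)"
  have "m * d $ 1 - m * c $ 1 = d $ 2 - c $ 2" "u * d $ 1 - u * c $ 1 = d $ 3 - c $ 3"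
    unfolding right_diff_distrib[symmetric] m_def u_def using assms by simp_all
  then have "c \<in> line3 m (c $ 2 - m * c $ 1) u (c $ 3 - u * c $ 1)"
    "d \<in> line3 m (c $ 2 - m * c $ 1) u (c $ 3 - u * c $ 1)"
    by (auto simp: line3_def)
  then show ?thesis
    by (intro that) (auto simp: graph_line3_def)
qed

lemma line2_eq_iff: "line2 m b = line2 m' b' \<longleftrightarrow> m = m' \<and> b = b'"
proof
  assume eq: "line2 m b = line2 m' b'"
  have "vector [0, b] \<in> line2 m b" "vector [1, m + b] \<in> line2 m b"
    by (auto simp: line2_def)
  then show "m = m' \<and> b = b'"
    unfolding eq by (auto simp: line2_def)
qed simp

lemma slope_line2: "slope (line2 m b) = m"
  unfolding slope_def
proof (rule the_equality)
  show "\<exists>c. line2 m b = {q. q $ 2 = m * q $ 1 + c}"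
    by (auto simp: line2_def)
  fix m' assume "\<exists>c. line2 m b = {q. q $ 2 = m' * q $ 1 + c}"
  then show "m' = m"
    using line2_eq_iff[of m b m'] unfolding line2_def[of m'] by auto
qed

lemma graph_line3_proj:
  assumes "graph_line3 L"
  obtains m b where "proj ` L = line2 m b" "slope (proj ` L) = m"
  using assms that by (auto simp: graph_line3_def proj_line3 slope_line2)

lemma graph_line3_proj_nonvertical: "graph_line3 L \<Longrightarrow> nonvertical_line2 (proj ` L)"
  by (auto simp: graph_line3_def proj_line3 nonvertical_line2_line2)

lemma ex_meeting_abscissa:
  fixes m m' b b' :: real
  assumes "m \<noteq> m'"
  obtains x where "\<And>y. m * y + b = m' * y + b' \<longleftrightarrow> y = x"
  using that[of "(b' - b) / (m - m')"] assms by (auto simp: field_simps)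

lemma line2_Int:
  assumes "m \<noteq> m'"
  obtains q where "line2 m b \<inter> line2 m' b' = {q}"
proof -
  obtain x where x: "\<And>y. m * y + b = m' * y + b' \<longleftrightarrow> y = x"
    using ex_meeting_abscissa[OF assms, of b b'] by blast
  have "q \<in> line2 m b \<inter> line2 m' b' \<longleftrightarrow> q $ 1 = x \<and> q $ 2 = m * x + b" for q
    using x[of "q $ 1"] by (auto simp: line2_def)
  then have "line2 m b \<inter> line2 m' b' = {vector [x, m * x + b]}"
    by (intro set_eqI) (auto simp: vec_eq_iff forall_2)
  then show ?thesis
    by (rule that)
qed

lemma graph_line3_proj_Int:
  assumes "graph_line3 L" "graph_line3 L'" "slope (proj ` L) \<noteq> slope (proj ` L')"
  obtains q where "proj ` L \<inter> proj ` L' = {q}"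
  using assms(3) graph_line3_proj[OF assms(1)] graph_line3_proj[OF assms(2)] line2_Int by metis

lemma graph_line3_not_parallel:
  assumes "graph_line3 L" "graph_line3 L'" "slope (proj ` L) \<noteq> slope (proj ` L')"
  shows "\<not> affine_parallel (proj ` L) (proj ` L')"
proof
  obtain m b m' b' where lines: "proj ` L = line2 m b" "proj ` L' = line2 m' b'"
    and slopes: "slope (proj ` L) = m" "slope (proj ` L') = m'"
    using graph_line3_proj[OF assms(1)] graph_line3_proj[OF assms(2)] by metis
  assume "affine_parallel (proj ` L) (proj ` L')"
  then obtain a where a: "line2 m' b' = (\<lambda>x. a + x) ` line2 m b"
    unfolding lines by (auto simp: affine_parallel_def)
  have "a + vector [0, b] \<in> line2 m' b'" "a + vector [1, m + b] \<in> line2 m' b'"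
    unfolding a by (auto simp: line2_def)
  then have "m = m'"
    by (auto simp: line2_def algebra_simps)
  then show False
    using assms(3) slopes by simp
qed

lemma point_above_line2_iff: "point_above_line q (line2 m b) \<longleftrightarrow> m * q $ 1 + b < q $ 2"
  unfolding point_above_line_def line2_def
  by (auto intro!: exI[of _ "vector [q $ 1, m * q $ 1 + b]"])

lemma point_below_line2_iff: "point_below_line q (line2 m b) \<longleftrightarrow> q $ 2 < m * q $ 1 + b"
  unfolding point_below_line_def line2_def
  by (auto intro!: exI[of _ "vector [q $ 1, m * q $ 1 + b]"])

lemma point_above_or_below_graph_line3:
  assumes "graph_line3 L" "q \<notin> proj ` L"
  shows "point_above_line q (proj ` L) \<or> point_below_line q (proj ` L)"
proof -
  obtain m b where line: "proj ` L = line2 m b"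
    by (rule graph_line3_proj[OF assms(1)])
  then have "q $ 2 \<noteq> m * q $ 1 + b"
    using assms(2) by (auto simp: line2_def)
  then show ?thesis
    by (auto simp: line point_above_line2_iff point_below_line2_iff)
qed

lemma crossing_point_line3:
  assumes x: "\<And>y. m * y + b = m' * y + b' \<longleftrightarrow> y = x"
  shows "crossing_point (line3 m b u v) (line3 m' b' u' v') = vector [x, m * x + b, u * x + v]"
proof -
  have "common_vertical (line3 m b u v) (line3 m' b' u' v') = {p. p $ 1 = x \<and> p $ 2 = m * x + b}"
    unfolding common_vertical_def
  proof (rule the_equality)
    let ?V = "{p::real^3. p $ 1 = x \<and> p $ 2 = m * x + b}"
    have "vector [x, m * x + b, u * x + v] \<in> ?V \<inter> line3 m b u v"
      "vector [x, m' * x + b', u' * x + v'] \<in> ?V \<inter> line3 m' b' u' v'"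
      using x[of x] by (auto simp: line3_def)
    then have "?V \<inter> line3 m b u v \<noteq> {}" "?V \<inter> line3 m' b' u' v' \<noteq> {}"
      by blast+
    then show "vertical_line3 ?V \<and> ?V \<inter> line3 m b u v \<noteq> {} \<and> ?V \<inter> line3 m' b' u' v' \<noteq> {}"
      by (auto simp: vertical_line3_def)
  next
    fix V assume V: "vertical_line3 V \<and> V \<inter> line3 m b u v \<noteq> {} \<and> V \<inter> line3 m' b' u' v' \<noteq> {}"
    then obtain s t where st: "V = {p. p $ 1 = s \<and> p $ 2 = t}"
      by (auto simp: vertical_line3_def)
    then have "t = m * s + b" "t = m' * s + b'"
      using V by (auto simp: line3_def)
    then show "V = {p. p $ 1 = x \<and> p $ 2 = m * x + b}"
      using st x[of s] by simp
  qed
  then show ?thesis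
    unfolding crossing_point_def
    by (intro the_equality) (auto simp: line3_def vec_eq_iff forall_3)
qed

lemma line_below_eq_or_above_eq:
  assumes "graph_line3 L" "graph_line3 L'" "slope (proj ` L) \<noteq> slope (proj ` L')"
  shows "line_below_eq L L' \<or> line_above_eq L L'"
proof -
  obtain m b u v m' b' u' v' where L: "L = line3 m b u v" "L' = line3 m' b' u' v'"
    using assms(1,2) by (auto simp: graph_line3_def)
  have "m \<noteq> m'"
    using assms(3) by (simp add: L proj_line3 slope_line2)
  then obtain x where x: "\<And>y. m * y + b = m' * y + b' \<longleftrightarrow> y = x"
    using ex_meeting_abscissa[of m m' b b'] by blast
  then have x': "m' * y + b' = m * y + b \<longleftrightarrow> y = x" for y
    by metis
  have heights: "crossing_point L L' $ 3 = u * x + v" "crossing_point L' L $ 3 = u' * x + v'"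
    unfolding L crossing_point_line3[OF x] crossing_point_line3[OF x'] by simp_all
  show ?thesis
  proof (cases "u * x + v = u' * x + v'")
    case True
    then have "vector [x, m * x + b, u * x + v] \<in> L \<inter> L'"
      using x[of x] by (simp add: L line3_def)
    then show ?thesis
      by (auto simp: line_below_eq_def)
  next
    case False
    then show ?thesis
      by (auto simp: line_below_eq_def line_above_eq_def line_below_def line_above_def heights)
  qed
qed

lemma line_above_eq_commute: "line_above_eq L L' \<longleftrightarrow> line_below_eq L' L"
  by (auto simp: line_above_eq_def line_below_eq_def line_above_def line_below_def)

subsection \<open>Realization by lines\<close>

lemma lift_segment:
  assumes "convex K" and sub: "closed_segment c d \<subseteq> proj ` K" and "c $ 1 \<noteq> d $ 1"
  obtains L where "graph_line3 L" "closed_segment c d \<subseteq> proj ` (K \<inter> L)"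
proof -
  obtain C D where C: "C \<in> K" "c = proj C" and D: "D \<in> K" "d = proj D"
    using subsetD[OF sub ends_in_segment(1)] subsetD[OF sub ends_in_segment(2)] by blast
  then obtain L where L: "graph_line3 L" "C \<in> L" "D \<in> L"
    using graph_line3_through[of C D] assms(3) by auto
  have "convex L"
    using L(1) by (auto simp: graph_line3_def line3_affine_hull affine_imp_convex)
  then have "closed_segment C D \<subseteq> K \<inter> L"
    using C D L assms(1) by (intro closed_segment_subset convex_Int) auto
  moreover have "closed_segment c d = proj ` closed_segment C D"
    unfolding C(2) D(2) by (rule closed_segment_linear_image[OF linear_proj])
  ultimately show ?thesis
    using that[OF L(1)] by blast
qed

locale simple_graph_lines =
  fixes I :: "'i set" and l :: "'i \<Rightarrow> (real^3) set"
  assumes graph: "i \<in> I \<Longrightarrow> graph_line3 (l i)"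
    and inj_slope: "inj_on (\<lambda>i. slope (proj ` l i)) I"
    and simple: "i \<in> I \<Longrightarrow> j \<in> I \<Longrightarrow> k \<in> I \<Longrightarrow> i \<noteq> j \<Longrightarrow> i \<noteq> k \<Longrightarrow> j \<noteq> k \<Longrightarrow>
      proj ` l i \<inter> proj ` l j \<inter> proj ` l k = {}"
begin

lemma reindex:
  assumes "inj_on f J" "f ` J \<subseteq> I"
  shows "simple_graph_lines J (l \<circ> f)"
proof
  have mem: "f i \<in> I" if "i \<in> J" for i
    using assms(2) that by blast
  then show "graph_line3 ((l \<circ> f) i)" if "i \<in> J" for i
    using graph that by simp
  show "inj_on (\<lambda>i. slope (proj ` (l \<circ> f) i)) J"
    using comp_inj_on[OF assms(1) inj_on_subset[OF inj_slope assms(2)]] by (simp add: comp_def)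
  show "proj ` (l \<circ> f) i \<inter> proj ` (l \<circ> f) j \<inter> proj ` (l \<circ> f) k = {}"
    if "i \<in> J" "j \<in> J" "k \<in> J" "i \<noteq> j" "i \<noteq> k" "j \<noteq> k" for i j k
    using simple[of "f i" "f j" "f k"] mem inj_onD[OF assms(1)] that by auto
qed

lemma slope_neq: "i \<in> I \<Longrightarrow> j \<in> I \<Longrightarrow> i \<noteq> j \<Longrightarrow> slope (proj ` l i) \<noteq> slope (proj ` l j)"
  using inj_onD[OF inj_slope] by blast

end

definition graph_realization :: "((real^3) set \<Rightarrow> (real^3) set) \<Rightarrow> (real^3) set set \<Rightarrow> bool" where
  "graph_realization L \<K> \<longleftrightarrow> (\<forall>K\<in>\<K>. graph_line3 (L K)) \<and> inj_on (\<lambda>K. slope (proj ` L K)) \<K> \<and>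
     pairwise (\<lambda>K K'. proj ` (K \<inter> L K) \<inter> proj ` (K' \<inter> L K') \<noteq> {}) \<K>"

lemma graph_realization_slope_neq:
  assumes "graph_realization L \<K>" "A \<in> \<K>" "B \<in> \<K>" "A \<noteq> B"
  shows "slope (proj ` L A) \<noteq> slope (proj ` L B)"
proof -
  have "inj_on (\<lambda>K. slope (proj ` L K)) \<K>"
    using assms(1) by (simp add: graph_realization_def)
  then show ?thesis
    using assms(2-4) by (auto dest: inj_onD)
qed

lemma graph_realization_Int_subset:
  assumes real: "graph_realization L \<K>" and AB: "A \<in> \<K>" "B \<in> \<K>" "A \<noteq> B"
  shows "proj ` L A \<inter> proj ` L B \<subseteq> proj ` A \<inter> proj ` B"
proof -
  have "graph_line3 (L A)" "graph_line3 (L B)"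
    using real AB by (auto simp: graph_realization_def)
  then obtain q where q: "proj ` L A \<inter> proj ` L B = {q}"
    by (rule graph_line3_proj_Int) (rule graph_realization_slope_neq[OF real AB])
  have "proj ` (A \<inter> L A) \<inter> proj ` (B \<inter> L B) \<noteq> {}"
    using real AB by (simp add: graph_realization_def pairwise_def)
  then obtain w where w: "w \<in> proj ` (A \<inter> L A)" "w \<in> proj ` (B \<inter> L B)"
    by (meson disjoint_iff)
  then have "w \<in> proj ` L A \<inter> proj ` L B" "w \<in> proj ` A \<inter> proj ` B"
    by blast+
  then show ?thesis
    unfolding q by simp
qed

lemma simple_graph_lines_if_graph_realization:
  assumes "graph_realization L \<K>" "strictly_2_overlapping \<K>"
  shows "simple_graph_lines \<K> L"
proof
  fix A B C assume ABC: "A \<in> \<K>" "B \<in> \<K>" "C \<in> \<K>" "A \<noteq> B" "A \<noteq> C" "B \<noteq> C"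
  have "x \<in> proj ` A \<inter> proj ` B \<inter> proj ` C" if "x \<in> proj ` L A \<inter> proj ` L B \<inter> proj ` L C" for x
    using that subsetD[OF graph_realization_Int_subset[OF assms(1) ABC(1,2,4)], of x]
      subsetD[OF graph_realization_Int_subset[OF assms(1) ABC(1,3,5)], of x] by simp
  moreover have "proj ` A \<inter> proj ` B \<inter> proj ` C = {}"
    using assms(2) ABC by (simp add: strictly_2_overlapping_def strictly_2_intersecting_def)
  ultimately show "proj ` L A \<inter> proj ` L B \<inter> proj ` L C = {}"
    by (metis all_not_in_conv)
qed (use assms(1) in \<open>simp_all add: graph_realization_def\<close>)

lemma realized_by_if_graph_realization:
  assumes "graph_realization L \<K>" "inj_on K {1..n}" "K ` {1..n} \<subseteq> \<K>"
  shows "realized_by n K (L \<circ> K)"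
proof -
  have mem: "K i \<in> \<K>" if "i \<in> {1..n}" for i
    using assms(3) that by blast
  have neq: "K i \<noteq> K j" if "i \<in> {1..n}" "j \<in> {1..n}" "i < j" for i j
    using inj_onD[OF assms(2)] that by blast
  have "nonvertical_line3 (L (K i))" if "i \<in> {1..n}" for i
    using assms(1) mem[OF that] graph_line3_nonvertical by (simp add: graph_realization_def)
  moreover have "proj ` (K i \<inter> L (K i)) \<inter> proj ` (K j \<inter> L (K j)) \<noteq> {}"
    if "i \<in> {1..n}" "j \<in> {1..n}" "i < j" for i j
    using assms(1) mem neq that by (simp add: graph_realization_def pairwise_def)
  moreover have "\<not> affine_parallel (proj ` L (K i)) (proj ` L (K j))"
    if "i \<in> {1..n}" "j \<in> {1..n}" "i < j" for i j
    using graph_line3_not_parallel graph_realization_slope_neq[OF assms(1) mem mem neq]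
      assms(1) mem that
    by (simp add: graph_realization_def)
  ultimately show ?thesis
    unfolding realized_by_def comp_def by blast
qed

lemma (in convex_2_intersecting) pairwise_crossing_not_collinear:
  assumes J: "J \<subseteq> I" "3 \<le> card J" and seg: "\<And>i. i \<in> J \<Longrightarrow> closed_segment (c i) (d i) \<subseteq> K i"
    and cross: "pairwise_crossing J c d" and ij: "i \<in> J" "j \<in> J" "i \<noteq> j"
  shows "\<not> collinear (closed_segment (c i) (d i) \<union> closed_segment (c j) (d j))"
proof -
  have "\<not> J \<subseteq> {i, j}"
    using J(2) card_mono[of "{i, j}" J] ij(3) by auto
  then obtain k where k: "k \<in> J" "i \<noteq> k" "j \<noteq> k"
    by blast
  show ?thesis
    by (rule crossing_segments_not_collinear[of i j k, OF _ _ _ ij(3) k(2,3)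
          seg[OF ij(1)] seg[OF ij(2)] seg[OF k(1)]])
       (use cross J(1) ij k in \<open>auto simp: pairwise_crossing_def pairwise_def subset_iff\<close>)
qed

lemma collinear_vertical_segments:
  fixes c d c' d' :: "real^2"
  assumes "c $ 1 = d $ 1" "c' $ 1 = d' $ 1" "closed_segment c d \<inter> closed_segment c' d' \<noteq> {}"
  shows "collinear (closed_segment c d \<union> closed_segment c' d')"
proof -
  have vertical: "p $ 1 = c $ 1" if "p \<in> closed_segment c d" "c $ 1 = d $ 1" for p c d :: "real^2"
    using imageI[OF that(1), of "\<lambda>p. p $ 1"] that(2) by (simp add: closed_segment_nth)
  obtain w where "w \<in> closed_segment c d" "w \<in> closed_segment c' d'"
    using assms(3) by blast
  then have "c' $ 1 = c $ 1"
    using vertical[of w c d] vertical[of w c' d'] assms(1,2) by simp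
  then have "p $ 1 = c $ 1" if "p \<in> closed_segment c d \<union> closed_segment c' d'" for p
    using vertical[of p c d] vertical[of p c' d'] assms(1,2) that by auto
  then have "closed_segment c d \<union> closed_segment c' d' \<subseteq> {p. p $ 1 = c $ 1}"
    by blast
  moreover have "collinear {p::real^2. p $ 1 = c $ 1}"
    unfolding collinear_def
    by (rule exI[of _ "vector [0, 1]"]) (auto simp: vec_eq_iff forall_2)
  ultimately show ?thesis
    by (rule collinear_subset[rotated])
qed

lemma strictly_2_overlapping_subset:
  "strictly_2_overlapping \<K> \<Longrightarrow> \<J> \<subseteq> \<K> \<Longrightarrow> strictly_2_overlapping \<J>"
  unfolding strictly_2_overlapping_def strictly_2_intersecting_def by (meson subsetD)

lemma convex_2_intersecting_proj:
  assumes "\<And>K. K \<in> \<K> \<Longrightarrow> convex K" "strictly_2_overlapping \<K>"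
  shows "convex_2_intersecting \<K> ((`) proj)"
  using assms convex_linear_image[OF linear_proj]
  by unfold_locales (auto simp: strictly_2_overlapping_def)

text \<open>
  At most one of the crossing segments is vertical, as two would be collinear. Excluding collinear
  pairs takes a third segment, hence the margin of three for every \<open>n\<close>.
\<close>

lemma ex_nonvertical_crossing_segments:
  fixes K :: "'i \<Rightarrow> (real^2) set"
  assumes "convex_2_intersecting I K" and "has_crossing_segments (n + 3) I K"
  obtains J c d where "J \<subseteq> I" "card J = n" "pairwise_crossing J c d"
    "\<And>i. i \<in> J \<Longrightarrow> closed_segment (c i) (d i) \<subseteq> K i \<and> c i $ 1 \<noteq> d i $ 1"
    "\<And>i j. i \<in> J \<Longrightarrow> j \<in> J \<Longrightarrow> i \<noteq> j \<Longrightarrow>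
      \<not> collinear (closed_segment (c i) (d i) \<union> closed_segment (c j) (d j))"
proof -
  interpret convex_2_intersecting I K by fact
  obtain A c d where A: "A \<subseteq> I" "card A = n + 3" and cross: "pairwise_crossing A c d"
    and seg: "\<And>i. i \<in> A \<Longrightarrow> closed_segment (c i) (d i) \<subseteq> K i"
    using assms(2) unfolding has_crossing_segments_def by blast
  have not_collinear: "\<not> collinear (closed_segment (c i) (d i) \<union> closed_segment (c j) (d j))"
    if "i \<in> A" "j \<in> A" "i \<noteq> j" for i j
    by (rule pairwise_crossing_not_collinear[OF A(1) _ seg cross that]) (use A(2) in simp)
  define V where "V = {i \<in> A. c i $ 1 = d i $ 1}"
  have fin: "finite A" "finite V"
    using A(2) by (auto simp: V_def card_ge_0_finite)
  have "i = j" if "i \<in> V" "j \<in> V" for i j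
    using collinear_vertical_segments[of "c i" "d i" "c j" "d j"] not_collinear[of i j] cross that
    by (auto simp: V_def pairwise_crossing_def pairwise_def)
  then have "card V \<le> 1"
    using card_le_Suc0_iff_eq[OF fin(2)] by (metis One_nat_def)
  then have "n \<le> card (A - V)"
    using A(2) diff_card_le_card_Diff[of V A] fin by simp
  then obtain J where J: "J \<subseteq> A - V" "card J = n"
    by (meson obtain_subset_with_card_n)
  show ?thesis
  proof (rule that)
    show "J \<subseteq> I" "card J = n"
      using J A(1) by auto
    show "pairwise_crossing J c d"
      using cross J(1) unfolding pairwise_crossing_def by (blast intro: pairwise_subset)
    show "closed_segment (c i) (d i) \<subseteq> K i \<and> c i $ 1 \<noteq> d i $ 1" if "i \<in> J" for i
      using that J(1) seg by (auto simp: V_def)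
    show "\<not> collinear (closed_segment (c i) (d i) \<union> closed_segment (c j) (d j))"
      if "i \<in> J" "j \<in> J" "i \<noteq> j" for i j
      using not_collinear J(1) that by blast
  qed
qed

lemma parallel_crossing_segments_collinear:
  assumes "graph_line3 L" "graph_line3 L'" "slope (proj ` L) = slope (proj ` L')"
    and sub: "S \<subseteq> proj ` L" "S' \<subseteq> proj ` L'" and meet: "S \<inter> S' \<noteq> {}"
  shows "collinear (S \<union> S')"
proof -
  obtain m b b' where lines: "proj ` L = line2 m b" "proj ` L' = line2 m b'"
    using graph_line3_proj[OF assms(1)] graph_line3_proj[OF assms(2)] assms(3) by metis
  obtain w where "w \<in> line2 m b" "w \<in> line2 m b'"
    using meet sub unfolding lines by blast
  then have "b = b'"
    by (simp add: line2_def)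
  then show ?thesis
    using sub unfolding lines by (intro collinear_subset[OF collinear_line2]) simp
qed

lemma ex_graph_realization:
  assumes convex_members: "\<And>K. K \<in> \<K> \<Longrightarrow> convex K" and overlap: "strictly_2_overlapping \<K>"
    and crossing: "has_crossing_segments (n + 3) \<K> ((`) proj)"
  obtains \<J> L where "\<J> \<subseteq> \<K>" "card \<J> = n" "graph_realization L \<J>"
proof -
  obtain \<J> c d where \<J>: "\<J> \<subseteq> \<K>" "card \<J> = n" and cross: "pairwise_crossing \<J> c d"
    and seg: "\<And>K. K \<in> \<J> \<Longrightarrow> closed_segment (c K) (d K) \<subseteq> proj ` K \<and> c K $ 1 \<noteq> d K $ 1"
    and not_collinear: "\<And>A B. A \<in> \<J> \<Longrightarrow> B \<in> \<J> \<Longrightarrow> A \<noteq> B \<Longrightarrow>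
      \<not> collinear (closed_segment (c A) (d A) \<union> closed_segment (c B) (d B))"
    using ex_nonvertical_crossing_segments[OF convex_2_intersecting_proj[OF convex_members overlap]
      crossing]
    by metis
  define S where "S K = closed_segment (c K) (d K)" for K
  have meet: "S A \<inter> S B \<noteq> {}" if "A \<in> \<J>" "B \<in> \<J>" "A \<noteq> B" for A B
    using cross that by (simp add: S_def pairwise_crossing_def pairwise_def)
  have "\<exists>L. graph_line3 L \<and> S K \<subseteq> proj ` (K \<inter> L)" if "K \<in> \<J>" for K
  proof -
    have "convex K"
      using convex_members \<J>(1) that by blast
    then show ?thesis
      unfolding S_def using lift_segment seg[OF that] by metis
  qed
  then obtain L where graph: "\<And>K. K \<in> \<J> \<Longrightarrow> graph_line3 (L K)"
    and lift: "\<And>K. K \<in> \<J> \<Longrightarrow> S K \<subseteq> proj ` (K \<inter> L K)"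
    by metis
  have sub: "S K \<subseteq> proj ` L K" if "K \<in> \<J>" for K
    using lift[OF that] by blast
  have "slope (proj ` L A) \<noteq> slope (proj ` L B)" if AB: "A \<in> \<J>" "B \<in> \<J>" "A \<noteq> B" for A B
    using parallel_crossing_segments_collinear[OF graph graph _ sub sub meet[OF AB]]
      not_collinear[OF AB] AB(1,2)
    by (auto simp: S_def)
  moreover have "proj ` (A \<inter> L A) \<inter> proj ` (B \<inter> L B) \<noteq> {}" if AB: "A \<in> \<J>" "B \<in> \<J>" "A \<noteq> B" for A B
    using Int_mono[OF lift[OF AB(1)] lift[OF AB(2)]] meet[OF AB] by (metis subset_empty)
  ultimately have "graph_realization L \<J>"
    using graph by (auto simp: graph_realization_def inj_on_def pairwise_def)
  then show ?thesis
    using that \<J> by blast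
qed

subsection \<open>Monotone subsequences\<close>

definition crossing_above :: "('i \<Rightarrow> (real^2) set) \<Rightarrow> 'i \<Rightarrow> 'i \<Rightarrow> 'i \<Rightarrow> bool" where
  "crossing_above X i j k \<longleftrightarrow> (\<exists>q. X i \<inter> X k = {q} \<and> point_above_line q (X j))"

definition crossing_below :: "('i \<Rightarrow> (real^2) set) \<Rightarrow> 'i \<Rightarrow> 'i \<Rightarrow> 'i \<Rightarrow> bool" where
  "crossing_below X i j k \<longleftrightarrow> (\<exists>q. X i \<inter> X k = {q} \<and> point_below_line q (X j))"

lemma (in simple_graph_lines) crossing_above_or_below:
  assumes "i \<in> I" "j \<in> I" "k \<in> I" "i \<noteq> j" "i \<noteq> k" "j \<noteq> k"
  shows "crossing_above (\<lambda>i. proj ` l i) i j k \<or> crossing_below (\<lambda>i. proj ` l i) i j k"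
proof -
  obtain q where q: "proj ` l i \<inter> proj ` l k = {q}"
    by (rule graph_line3_proj_Int[OF graph[OF assms(1)] graph[OF assms(3)]
          slope_neq[OF assms(1,3,5)]])
  then have "q \<notin> proj ` l j"
    using simple[OF assms] by blast
  then have "point_above_line q (proj ` l j) \<or> point_below_line q (proj ` l j)"
    by (rule point_above_or_below_graph_line3[OF graph[OF assms(2)]])
  with q show ?thesis
    by (auto simp: crossing_above_def crossing_below_def)
qed

definition sorted_cap :: "'i::linorder set \<Rightarrow> ('i \<Rightarrow> (real^2) set) \<Rightarrow> bool" where
  "sorted_cap I X \<longleftrightarrow> (\<forall>i\<in>I. \<forall>j\<in>I. i < j \<longrightarrow> slope (X j) < slope (X i)) \<and>
     (\<forall>i\<in>I. \<forall>j\<in>I. \<forall>k\<in>I. i < j \<and> j < k \<longrightarrow> crossing_above X i j k)"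

definition sorted_cup :: "'i::linorder set \<Rightarrow> ('i \<Rightarrow> (real^2) set) \<Rightarrow> bool" where
  "sorted_cup I X \<longleftrightarrow> (\<forall>i\<in>I. \<forall>j\<in>I. i < j \<longrightarrow> slope (X i) < slope (X j)) \<and>
     (\<forall>i\<in>I. \<forall>j\<in>I. \<forall>k\<in>I. i < j \<and> j < k \<longrightarrow> crossing_below X i j k)"

definition monotone_levels :: "'i::linorder set \<Rightarrow> ('i \<Rightarrow> (real^3) set) \<Rightarrow> bool" where
  "monotone_levels I l \<longleftrightarrow> (\<forall>i\<in>I. \<forall>j\<in>I. i < j \<longrightarrow> line_below_eq (l i) (l j)) \<or>
     (\<forall>i\<in>I. \<forall>j\<in>I. i < j \<longrightarrow> line_above_eq (l i) (l j))"

lemma monotone_levels_reversal: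
  fixes I :: "int set"
  assumes "monotone_levels I l"
  shows "monotone_levels (uminus ` I) (l \<circ> uminus)"
  using assms by (simp add: monotone_levels_def line_above_eq_commute) blast

lemma ex_monotone_lines_if_sorted:
  fixes I :: "'i::linorder set"
  assumes lines: "simple_graph_lines I l" and I: "finite I" "card I = n" "3 \<le> n"
    and cap_or_cup: "sorted_cap I (\<lambda>i. proj ` l i) \<or> sorted_cup I (\<lambda>i. proj ` l i)"
    and levels: "monotone_levels I l"
  obtains g where "bij_betw g {1..n} I" "monotone_lines n (l \<circ> g)"
proof -
  interpret simple_graph_lines I l by (rule lines)
  obtain g where bij: "bij_betw g {1..n} I" and mono: "strict_mono_on {1..n} g"
    using ex_strict_mono_enumeration[OF I(1)] I(2) by blast
  have mem: "g i \<in> I" if "i \<in> {1..n}" for i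
    using bij_betwE[OF bij] that by blast
  have less: "g i < g j" if "i \<in> {1..n}" "j \<in> {1..n}" "i < j" for i j
    using strict_mono_onD[OF mono that] .
  define X where "X i = proj ` l i" for i
  have "X (g i) \<inter> X (g j) \<inter> X (g k) = {}"
    if "i \<in> {1..n}" "j \<in> {1..n}" "k \<in> {1..n}" "i < j" "j < k" for i j k
    using simple[OF mem mem mem, of i j k] less[of i j] less[of j k] that by (auto simp: X_def)
  then have simple_X: "simple_lines n (X \<circ> g)"
    using graph_line3_proj_nonvertical graph mem by (simp add: simple_lines_def X_def)
  have "is_cap n (X \<circ> g) \<or> is_cup n (X \<circ> g)"
    using cap_or_cup unfolding X_def[symmetric]
  proof
    assume "sorted_cap I X"
    then have "is_cap n (X \<circ> g)"
      using simple_X I(3) by (auto simp: is_cap_def sorted_cap_def crossing_above_def mem less)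
    then show ?thesis ..
  next
    assume "sorted_cup I X"
    then have "is_cup n (X \<circ> g)"
      using simple_X I(3) by (auto simp: is_cup_def sorted_cup_def crossing_below_def mem less)
    then show ?thesis ..
  qed
  moreover have "(\<forall>i\<in>{1..<n}. line_below_eq (l (g i)) (l (g (i + 1)))) \<or>
      (\<forall>i\<in>{1..<n}. line_above_eq (l (g i)) (l (g (i + 1))))"
    using levels unfolding monotone_levels_def by (rule disj_forward) (auto simp: mem less)
  moreover have "\<forall>i\<in>{1..n}. nonvertical_line3 (l (g i))"
    using graph_line3_nonvertical graph mem by blast
  ultimately show ?thesis
    using I(3) by (intro that[OF bij]) (simp add: monotone_lines_def X_def comp_def)
qed

lemma ex_monotone_lines_if_homogeneous:
  fixes H :: "int set"
  assumes lines: "simple_graph_lines H l" and H: "finite H" "card H = n" "3 \<le> n"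
    and slopes: "\<And>i j. i \<in> H \<Longrightarrow> j \<in> H \<Longrightarrow> i < j \<Longrightarrow> slope (proj ` l i) < slope (proj ` l j)"
    and crossings: "\<And>i j k. i \<in> H \<Longrightarrow> j \<in> H \<Longrightarrow> k \<in> H \<Longrightarrow> i < j \<Longrightarrow> j < k \<Longrightarrow>
      crossing_above (\<lambda>i. proj ` l i) i j k = b"
    and levels: "monotone_levels H l"
  obtains g where "bij_betw g {1..n} H" "monotone_lines n (l \<circ> g)"
proof -
  interpret simple_graph_lines H l by (rule lines)
  show ?thesis
  proof (cases b)
    case True
    have "crossing_above (\<lambda>i. proj ` (l \<circ> uminus) i) i j k"
      if "i \<in> uminus ` H" "j \<in> uminus ` H" "k \<in> uminus ` H" "i < j" "j < k" for i j k
      using crossings[of "- k" "- j" "- i"] that True by (auto simp: crossing_above_def Int_commute)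
    then have "sorted_cap (uminus ` H) (\<lambda>i. proj ` (l \<circ> uminus) i)"
      using slopes by (auto simp: sorted_cap_def)
    moreover have "simple_graph_lines (uminus ` H) (l \<circ> uminus)"
      by (rule reindex) auto
    ultimately obtain g where g: "bij_betw g {1..n} (uminus ` H)"
      "monotone_lines n ((l \<circ> uminus) \<circ> g)"
      using ex_monotone_lines_if_sorted[of "uminus ` H" "l \<circ> uminus" n] H
        monotone_levels_reversal[OF levels]
      by (auto simp: card_image)
    have "bij_betw uminus (uminus ` H) H"
      by (rule bij_betw_byWitness[of _ uminus]) auto
    then have "bij_betw (uminus \<circ> g) {1..n} H"
      by (rule bij_betw_trans[OF g(1)])
    then show ?thesis
      using g(2) by (intro that) (simp_all add: comp_assoc)
  next
    case False
    have "crossing_below (\<lambda>i. proj ` l i) i j k"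
      if "i \<in> H" "j \<in> H" "k \<in> H" "i < j" "j < k" for i j k
      using crossings[OF that] False crossing_above_or_below[of i j k] that by auto
    then have "sorted_cup H (\<lambda>i. proj ` l i)"
      using slopes by (auto simp: sorted_cup_def)
    then show ?thesis
      using ex_monotone_lines_if_sorted[OF lines H _ levels] that by blast
  qed
qed

lemma ex_monotone_levels_subset:
  fixes I :: "int set"
  assumes lines: "simple_graph_lines I l" and I: "finite I" "ramsey_bound 2 n \<le> card I"
  obtains H where "H \<subseteq> I" "card H = n" "monotone_levels H l"
proof -
  interpret simple_graph_lines I l by (rule lines)
  obtain H b where H: "H \<subseteq> I" "card H = n"
    and below: "\<And>i j. i \<in> H \<Longrightarrow> j \<in> H \<Longrightarrow> i < j \<Longrightarrow> line_below_eq (l i) (l j) = b"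
    by (rule ramsey_pairs[OF I, of "\<lambda>i j. line_below_eq (l i) (l j)"]) blast
  have "line_below_eq (l i) (l j) \<or> line_above_eq (l i) (l j)" if "i \<in> H" "j \<in> H" "i < j" for i j
    using line_below_eq_or_above_eq[OF graph graph slope_neq, of i j] H(1) that by auto
  then have "monotone_levels H l"
    using below unfolding monotone_levels_def by (cases b) blast+
  then show ?thesis
    using that[OF H] by blast
qed

lemma ex_monotone_lines:
  fixes l :: "'i \<Rightarrow> (real^3) set"
  assumes lines: "simple_graph_lines I l"
    and I: "finite I" "ramsey_bound 3 (ramsey_bound 2 n) \<le> card I" "3 \<le> n"
  obtains g where "inj_on g {1..n}" "g ` {1..n} \<subseteq> I" "monotone_lines n (l \<circ> g)"
proof -
  obtain A :: "int set" and e where A: "finite A" "card A = card I" and e: "bij_betw e A I"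
    and sorted: "mono_on A ((\<lambda>i. slope (proj ` l i)) \<circ> e)"
    by (rule ex_sorted_int_enumeration[OF I(1), of "\<lambda>i. slope (proj ` l i)"])
  define L where "L = l \<circ> e"
  have lines_subset: "simple_graph_lines J L" if "J \<subseteq> A" for J
  proof (unfold L_def, rule simple_graph_lines.reindex[OF lines])
    show "inj_on e J" "e ` J \<subseteq> I"
      using e that by (auto simp: bij_betw_def intro: inj_on_subset)
  qed
  have slopes: "slope (proj ` L i) < slope (proj ` L j)" if "i \<in> A" "j \<in> A" "i < j" for i j
    using mono_onD[OF sorted that(1,2)] that(3)
      simple_graph_lines.slope_neq[OF lines_subset[OF order_refl] that(1,2)]
    by (simp add: L_def)
  obtain J b where J: "J \<subseteq> A" "card J = ramsey_bound 2 n" and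
    crossings: "\<And>i j k. i \<in> J \<Longrightarrow> j \<in> J \<Longrightarrow> k \<in> J \<Longrightarrow> i < j \<Longrightarrow> j < k \<Longrightarrow>
      crossing_above (\<lambda>i. proj ` L i) i j k = b"
    by (rule ramsey_triples[of A "ramsey_bound 2 n" "crossing_above (\<lambda>i. proj ` L i)"])
       (use A I(2) in auto)
  have "finite J"
    using J(1) A(1) by (rule finite_subset)
  then obtain H where H: "H \<subseteq> J" "card H = n" and levels: "monotone_levels H L"
    using ex_monotone_levels_subset[OF lines_subset[OF J(1)]] J(2) by auto
  have HA: "H \<subseteq> A" and finH: "finite H"
    using H(1) J(1) A(1) by (auto intro: finite_subset)
  obtain g where g: "bij_betw g {1..n} H" "monotone_lines n (L \<circ> g)"
    by (rule ex_monotone_lines_if_homogeneous[OF lines_subset[OF HA] finH H(2) I(3)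
          _ _ levels, of b])
       (use slopes crossings H(1) HA in \<open>auto simp: subset_iff\<close>)
  have "inj_on (e \<circ> g) {1..n}"
    using g(1) e HA by (auto simp: bij_betw_def intro: comp_inj_on inj_on_subset)
  moreover have "(e \<circ> g) ` {1..n} \<subseteq> I"
    using g(1) e HA by (auto simp: bij_betw_def)
  ultimately show ?thesis
    using that g(2) by (simp add: L_def comp_assoc)
qed

theorem theorem2p3:
  fixes n :: nat
  assumes "n \<ge> 3"
  shows "\<exists>N2::nat. \<forall>\<K>::(real^3) set set.
    finite \<K> \<and> card \<K> = N2 \<and> (\<forall>K\<in>\<K>. convex K) \<and> strictly_2_overlapping \<K> \<longrightarrow>
    (\<exists>(K::nat \<Rightarrow> (real^3) set) (l::nat \<Rightarrow> (real^3) set).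
       (\<forall>i\<in>{1..n}. K i \<in> \<K>) \<and> inj_on K {1..n} \<and>
       monotone_lines n l \<and> realized_by n K l)"
proof (intro exI[of _ "planar_bound (ramsey_bound 3 (ramsey_bound 2 n) + 3)"] allI impI, elim conjE)
  let ?M = "ramsey_bound 3 (ramsey_bound 2 n)"
  fix \<K> :: "(real^3) set set"
  assume \<K>: "finite \<K>" "card \<K> = planar_bound (?M + 3)" "\<forall>K\<in>\<K>. convex K" "strictly_2_overlapping \<K>"
  have "has_crossing_segments (?M + 3) \<K> ((`) proj)"
    using crossing_segments[OF convex_2_intersecting_proj] \<K> by simp
  then obtain \<J> L where \<J>: "\<J> \<subseteq> \<K>" "card \<J> = ?M" and L: "graph_realization L \<J>"
    using ex_graph_realization \<K>(3,4) by metis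
  have "simple_graph_lines \<J> L"
    using simple_graph_lines_if_graph_realization[OF L]
      strictly_2_overlapping_subset[OF \<K>(4) \<J>(1)] by blast
  then obtain K where K: "inj_on K {1..n}" "K ` {1..n} \<subseteq> \<J>" and mono: "monotone_lines n (L \<circ> K)"
    using ex_monotone_lines[of \<J> L n] \<J> finite_subset[OF \<J>(1) \<K>(1)] assms by auto
  have "realized_by n K (L \<circ> K)"
    by (rule realized_by_if_graph_realization[OF L K])
  then show "\<exists>K l. (\<forall>i\<in>{1..n}. K i \<in> \<K>) \<and> inj_on K {1..n} \<and> monotone_lines n l \<and> realized_by n K l"
    using K mono \<J>(1) by blast
qed

end
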